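(* Let $(W,S)$ be a Coxeter system of finite rank with $m_{rt}<\infty$ for all $r,t\in S$. The isomorphism classes of IR-representations of $(W,S)$ are in one-to-one correspondence (by sending an IR-representation to its attached data $((k_{rt}),\chi)$) with the set of data $$\Bigl\{\bigl((k_{rt})_{r\neq t\in S},\chi\bigr)\Bigm| k_{rt}\in\mathbb{N},\ 1\le k_{rt}=k_{tr}\le \tfrac{m_{rt}}{2}\ \forall r\ne t\in S;\ \chi \text{ a character of } \mathrm{H}_1(\widetilde G)\Bigr\},$$ where the graph $\widetilde G$ is determined by $(k_{rt})_{r,t}$.
   Context: $W=\langle S\mid s^2=(st)^{m_{st}}=e,\ \forall s\ne t\in S\rangle$, $S$ finite. All representations are complex. IR-representation: a representation $V$ of $W$ having a basis $\{\alpha_s\mid s\in S\}$ such that for every $s\in S$ there is a subspace $H_s\subset V$ of codimension $1$ with $s|_{H_s}=\mathrm{Id}_{H_s}$, and $s\cdot\alpha_s=-\alpha_s$. For $r\ne t\in S$ and a natural number $1\le k\le m_{rt}/2$, $\rho_k$ is the representation of the dihedral group $\langle r,t\rangle$ on $\mathbb{C}\beta_r\oplus\mathbb{C}\beta_t$ given by $r\beta_r=-\beta_r$, $r\beta_t=\beta_t+2\cos\frac{k\pi}{m_{rt}}\beta_r$, $t\beta_t=-\beta_t$, $t\beta_r=\beta_r+2\cos\frac{k\pi}{m_{rt}}\beta_t$. Attached data: for an IR-representation $V$ and $r\ne t$, the span $\langle\alpha_r,\alpha_t\rangle$ is stable under $\langle r,t\rangle$ and isomorphic to $\rho_{k_{rt}}$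 for a unique $1\le k_{rt}=k_{tr}\le m_{rt}/2$; one chooses $a_r^t,a_t^r\in\mathbb{C}^\times$ such that $\beta_r\mapsto a_r^t\alpha_r$, $\beta_t\mapsto a_t^r\alpha_t$ is an isomorphism $\rho_{k_{rt}}\to\langle\alpha_r,\alpha_t\rangle$, so that $r\cdot\alpha_t=\alpha_t+2\frac{a_r^t}{a_t^r}\cos\frac{k_{rt}\pi}{m_{rt}}\alpha_r$. Graph: $\widetilde G$ is the graph with vertex set $S$ in which $\{r,t\}$ is an edge iff $\widetilde m_{rt}:=m_{rt}/\gcd(m_{rt},k_{rt})\ge3$ (equivalently $k_{rt}\ne m_{rt}/2$); i.e. the Coxeter graph of the Coxeter system with orders $\widetilde m_{rt}$. $\mathrm{H}_1(\widetilde G)=\ker(\partial:\mathrm C_1(\widetilde G)\to \mathrm C_0(\widetilde G))$ is the first integral homology group of $\widetilde G$ viewed as a 1-dimensional simplicial complex (labels ignored), $\mathrm C_1(\widetilde G)$ being generated by oriented edges $(r,t)$ with $(t,r)=-(r,t)$. A character is a homomorphism to $\mathbb{C}^\times$. The character $\chi$ attached to $V$ is the restriction to $\mathrm{H}_1(\widetilde G)$ of the homomorphism $\mathrm C_1(\widetilde G)\to\mathbb{C}^\times$, $(r,t)\mapsto a_t^r/a_r^t$. *)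

theory Defs
  imports Complex_Main "HOL-Algebra.Free_Abelian_Groups"
begin

section \<open>Coxeter systems\<close>

text \<open>A word is a list of signed letters; the letter \<open>(x, True)\<close> stands for the inverse of \<open>x\<close>.\<close>

type_synonym 'g word = "('g \<times> bool) list"

definition word_value :: "('g, 'b) monoid_scheme \<Rightarrow> 'g word \<Rightarrow> 'g" where
  "word_value G u =
     foldr (\<lambda>(x, b) g. (if b then inv\<^bsub>G\<^esub> x else x) \<otimes>\<^bsub>G\<^esub> g) u \<one>\<^bsub>G\<^esub>"

inductive word_equiv :: "'g set \<Rightarrow> 'g word set \<Rightarrow> 'g word \<Rightarrow> 'g word \<Rightarrow> bool"
  for S :: "'g set" and R :: "'g word set" where
  refl: "word_equiv S R u u"
| sym: "word_equiv S R u v \<Longrightarrow> word_equiv S R v u"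
| trans: "word_equiv S R u v \<Longrightarrow> word_equiv S R v w \<Longrightarrow> word_equiv S R u w"
| cong: "word_equiv S R u v \<Longrightarrow> word_equiv S R (p @ u @ q) (p @ v @ q)"
| cancel: "x \<in> S \<Longrightarrow> word_equiv S R [(x, b), (x, \<not> b)] []"
| relator: "r \<in> R \<Longrightarrow> word_equiv S R r []"

text \<open>\<open>G\<close> is the group with generators \<open>S \<subseteq> G\<close> and relators \<open>R\<close>.\<close>

definition presented_by :: "('g, 'b) monoid_scheme \<Rightarrow> 'g set \<Rightarrow> 'g word set \<Rightarrow> bool" where
  "presented_by G S R \<longleftrightarrow>
     group G \<and> S \<subseteq> carrier G \<and> generate G S = carrier G \<and>
     (\<forall>u \<in> lists (S \<times> UNIV). \<forall>v \<in> lists (S \<times> UNIV).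
        word_value G u = word_value G v \<longleftrightarrow> word_equiv S R u v)"

text \<open>The value \<open>m s t = 0\<close> encodes \<open>m\<^sub>s\<^sub>t = \<infinity>\<close>; the relator \<open>(st)\<^sup>0\<close> is the empty word
  and so imposes nothing.\<close>

definition coxeter_matrix :: "'g set \<Rightarrow> ('g \<Rightarrow> 'g \<Rightarrow> nat) \<Rightarrow> bool" where
  "coxeter_matrix S m \<longleftrightarrow>
     (\<forall>s\<in>S. m s s = 1) \<and> (\<forall>s\<in>S. \<forall>t\<in>S. s \<noteq> t \<longrightarrow> m s t = m t s \<and> m s t \<noteq> 1)"

definition coxeter_relators :: "'g set \<Rightarrow> ('g \<Rightarrow> 'g \<Rightarrow> nat) \<Rightarrow> 'g word set" where
  "coxeter_relators S m =
     {[(s, False), (s, False)] | s. s \<in> S} \<union>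
     {concat (replicate (m s t) [(s, False), (t, False)]) | s t. s \<in> S \<and> t \<in> S \<and> s \<noteq> t}"

definition coxeter_system ::
  "('g, 'b) monoid_scheme \<Rightarrow> 'g set \<Rightarrow> ('g \<Rightarrow> 'g \<Rightarrow> nat) \<Rightarrow> bool" where
  "coxeter_system W S m \<longleftrightarrow> coxeter_matrix S m \<and> presented_by W S (coxeter_relators S m)"


section \<open>First homology of a graph\<close>

text \<open>A graph is given by a symmetric set \<open>E\<close> of oriented edges. The group of 1-chains is the
  free abelian group on \<open>E\<close> modulo the relations \<open>(t, r) = - (r, t)\<close>.\<close>

definition reversal_relations :: "('v \<times> 'v) set \<Rightarrow> ('v \<times> 'v \<Rightarrow>\<^sub>0 int) set" where
  "reversal_relations E =
     generate (free_Abelian_group E) {frag_of (r, t) + frag_of (t, r) | r t. (r, t) \<in> E}"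

definition chains1 :: "('v \<times> 'v) set \<Rightarrow> ('v \<times> 'v \<Rightarrow>\<^sub>0 int) set monoid" where
  "chains1 E = free_Abelian_group E Mod reversal_relations E"

definition edge_chain :: "('v \<times> 'v) set \<Rightarrow> 'v \<Rightarrow> 'v \<Rightarrow> ('v \<times> 'v \<Rightarrow>\<^sub>0 int) set" where
  "edge_chain E r t = reversal_relations E #>\<^bsub>free_Abelian_group E\<^esub> frag_of (r, t)"

text \<open>The map on cosets induced by \<open>(r, t) \<mapsto> t - r\<close>, which kills the relations.\<close>

definition boundary :: "('v \<times> 'v \<Rightarrow>\<^sub>0 int) set \<Rightarrow> ('v \<Rightarrow>\<^sub>0 int)" where
  "boundary X = the_elem (frag_extend (\<lambda>(r, t). frag_of t - frag_of r) ` X)"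

definition H1 :: "'v set \<Rightarrow> ('v \<times> 'v) set \<Rightarrow> ('v \<times> 'v \<Rightarrow>\<^sub>0 int) set monoid" where
  "H1 S E = (chains1 E)\<lparr>carrier := kernel (chains1 E) (free_Abelian_group S) boundary\<rparr>"

definition complex_units :: "complex monoid" where
  "complex_units = \<lparr>carrier = UNIV - {0}, mult = (*), one = 1\<rparr>"

definition characters :: "('a, 'b) monoid_scheme \<Rightarrow> ('a \<Rightarrow> complex) set" where
  "characters G = hom G complex_units \<inter> extensional (carrier G)"


section \<open>The classifying data\<close>

definition off_diagonal :: "'g set \<Rightarrow> ('g \<times> 'g) set" where
  "off_diagonal S = {(r, t). r \<in> S \<and> t \<in> S \<and> r \<noteq> t}"

definition tilde_edges ::
  "'g set \<Rightarrow> ('g \<Rightarrow> 'g \<Rightarrow> nat) \<Rightarrow> ('g \<times> 'g \<Rightarrow> nat) \<Rightarrow> ('g \<times> 'g) set" where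
  "tilde_edges S m k = {(r, t) \<in> off_diagonal S. 3 \<le> m r t div gcd (m r t) (k (r, t))}"

definition IR_data ::
  "'g set \<Rightarrow> ('g \<Rightarrow> 'g \<Rightarrow> nat)
    \<Rightarrow> (('g \<times> 'g \<Rightarrow> nat) \<times> (('g \<times> 'g \<Rightarrow>\<^sub>0 int) set \<Rightarrow> complex)) set" where
  "IR_data S m =
     {(k, \<chi>). k \<in> extensional (off_diagonal S) \<and>
        (\<forall>(r, t) \<in> off_diagonal S. k (r, t) = k (t, r) \<and> 1 \<le> k (r, t) \<and> 2 * k (r, t) \<le> m r t) \<and>
        \<chi> \<in> characters (H1 S (tilde_edges S m k))}"

text \<open>The actions of \<open>r\<close> and \<open>t\<close> in \<open>\<rho>\<^sub>k\<close>, where \<open>m = m\<^sub>r\<^sub>t\<close> and the pair \<open>(x, y)\<close> stands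
  for \<open>x \<beta>\<^sub>r + y \<beta>\<^sub>t\<close>.\<close>

definition rho_r :: "nat \<Rightarrow> nat \<Rightarrow> complex \<times> complex \<Rightarrow> complex \<times> complex" where
  "rho_r m k = (\<lambda>(x, y). (- x + complex_of_real (2 * cos (real k * pi / real m)) * y, y))"

definition rho_t :: "nat \<Rightarrow> nat \<Rightarrow> complex \<times> complex \<Rightarrow> complex \<times> complex" where
  "rho_t m k = (\<lambda>(x, y). (x, - y + complex_of_real (2 * cos (real k * pi / real m)) * x))"


section \<open>IR-representations and their attached data\<close>

text \<open>Representation spaces are the subspaces \<open>V\<close> of an ambient complex vector space, which is
  arbitrary and only serves as a universe. A representation is a pair \<open>(V, \<rho>)\<close>; the values
  of \<open>\<rho> w\<close> outside \<open>V\<close> are irrelevant.\<close>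

locale complex_vector_space = vector_space scale
  for scale :: "complex \<Rightarrow> 'v::ab_group_add \<Rightarrow> 'v"
begin

definition linear_map_on :: "'v set \<Rightarrow> 'v set \<Rightarrow> ('v \<Rightarrow> 'v) \<Rightarrow> bool" where
  "linear_map_on V V' f \<longleftrightarrow>
     f \<in> V \<rightarrow> V' \<and> (\<forall>x\<in>V. \<forall>y\<in>V. f (x + y) = f x + f y) \<and>
     (\<forall>c. \<forall>x\<in>V. f (scale c x) = scale c (f x))"

definition group_representation :: "('g, 'b) monoid_scheme \<Rightarrow> 'v set \<Rightarrow> ('g \<Rightarrow> 'v \<Rightarrow> 'v) \<Rightarrow> bool" where
  "group_representation W V \<rho> \<longleftrightarrow>
     subspace V \<and> (\<forall>w\<in>carrier W. linear_map_on V V (\<rho> w)) \<and>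
     (\<forall>x\<in>V. \<rho> \<one>\<^bsub>W\<^esub> x = x) \<and>
     (\<forall>u\<in>carrier W. \<forall>w\<in>carrier W. \<forall>x\<in>V. \<rho> (u \<otimes>\<^bsub>W\<^esub> w) x = \<rho> u (\<rho> w x))"

definition IR_basis :: "'g set \<Rightarrow> 'v set \<Rightarrow> ('g \<Rightarrow> 'v \<Rightarrow> 'v) \<Rightarrow> ('g \<Rightarrow> 'v) \<Rightarrow> bool" where
  "IR_basis S V \<rho> \<alpha> \<longleftrightarrow>
     inj_on \<alpha> S \<and> independent (\<alpha> ` S) \<and> span (\<alpha> ` S) = V \<and>
     (\<forall>s\<in>S. (\<exists>H. subspace H \<and> H \<subseteq> V \<and> dim H + 1 = dim V \<and> (\<forall>x\<in>H. \<rho> s x = x)) \<and>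
            \<rho> s (\<alpha> s) = - \<alpha> s)"

definition IR_reps :: "('g, 'b) monoid_scheme \<Rightarrow> 'g set \<Rightarrow> ('v set \<times> ('g \<Rightarrow> 'v \<Rightarrow> 'v)) set" where
  "IR_reps W S = {(V, \<rho>). group_representation W V \<rho> \<and> (\<exists>\<alpha>. IR_basis S V \<rho> \<alpha>)}"

definition IR_iso :: "('g, 'b) monoid_scheme \<Rightarrow> 'g set \<Rightarrow>
    (('v set \<times> ('g \<Rightarrow> 'v \<Rightarrow> 'v)) \<times> ('v set \<times> ('g \<Rightarrow> 'v \<Rightarrow> 'v))) set" where
  "IR_iso W S =
     {((V, \<rho>), (V', \<rho>')). (V, \<rho>) \<in> IR_reps W S \<and> (V', \<rho>') \<in> IR_reps W S \<and>
        (\<exists>\<phi>. linear_map_on V V' \<phi> \<and> bij_betw \<phi> V V' \<and>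
             (\<forall>w\<in>carrier W. \<forall>x\<in>V. \<phi> (\<rho> w x) = \<rho>' w (\<phi> x)))}"

text \<open>\<open>\<beta>\<^sub>r \<mapsto> p \<alpha>\<^sub>r\<close>, \<open>\<beta>\<^sub>t \<mapsto> q \<alpha>\<^sub>t\<close> is an isomorphism from \<open>\<rho>\<^sub>k\<close> (with \<open>m = m\<^sub>r\<^sub>t\<close>) onto the span of
  \<open>\<alpha>\<^sub>r\<close> and \<open>\<alpha>\<^sub>t\<close>. As \<open>r\<close> and \<open>t\<close> generate the dihedral group, equivariance
  under these two elements is equivariance.\<close>

definition dihedral_iso :: "('g \<Rightarrow> 'v \<Rightarrow> 'v) \<Rightarrow> ('g \<Rightarrow> 'v) \<Rightarrow> 'g \<Rightarrow> 'g \<Rightarrow> nat \<Rightarrow> nat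
    \<Rightarrow> complex \<Rightarrow> complex \<Rightarrow> bool" where
  "dihedral_iso \<rho> \<alpha> r t m k p q \<longleftrightarrow>
     (let \<phi> = \<lambda>(x, y). scale (x * p) (\<alpha> r) + scale (y * q) (\<alpha> t) in
       bij_betw \<phi> UNIV (span {\<alpha> r, \<alpha> t}) \<and>
       (\<forall>z. \<phi> (rho_r m k z) = \<rho> r (\<phi> z)) \<and>
       (\<forall>z. \<phi> (rho_t m k z) = \<rho> t (\<phi> z)))"

text \<open>\<open>(k, \<chi>)\<close> arises from \<open>(V, \<rho>)\<close> by some choice of the basis \<open>\<alpha>\<close> and of the numbers
  \<open>a r t\<close>, which stand for \<open>a\<^sub>r\<^sup>t\<close> (subscript first).\<close>

definition has_data :: "'g set \<Rightarrow> ('g \<Rightarrow> 'g \<Rightarrow> nat) \<Rightarrow> ('v set \<times> ('g \<Rightarrow> 'v \<Rightarrow> 'v))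
    \<Rightarrow> (('g \<times> 'g \<Rightarrow> nat) \<times> (('g \<times> 'g \<Rightarrow>\<^sub>0 int) set \<Rightarrow> complex)) \<Rightarrow> bool" where
  "has_data S m = (\<lambda>(V, \<rho>) (k, \<chi>).
     k \<in> extensional (off_diagonal S) \<and>
     (\<exists>\<alpha> a. IR_basis S V \<rho> \<alpha> \<and>
        (\<forall>(r, t) \<in> off_diagonal S.
           k (r, t) = k (t, r) \<and> 1 \<le> k (r, t) \<and> 2 * k (r, t) \<le> m r t \<and>
           a r t \<noteq> 0 \<and> a t r \<noteq> 0 \<and>
           dihedral_iso \<rho> \<alpha> r t (m r t) (k (r, t)) (a r t) (a t r)) \<and>
        (\<exists>f \<in> hom (chains1 (tilde_edges S m k)) complex_units.
           (\<forall>(r, t) \<in> tilde_edges S m k. f (edge_chain (tilde_edges S m k) r t) = a t r / a r t) \<and>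
           \<chi> = restrict f (carrier (H1 S (tilde_edges S m k))))))"

definition attached_data :: "'g set \<Rightarrow> ('g \<Rightarrow> 'g \<Rightarrow> nat) \<Rightarrow> ('v set \<times> ('g \<Rightarrow> 'v \<Rightarrow> 'v))
    \<Rightarrow> (('g \<times> 'g \<Rightarrow> nat) \<times> (('g \<times> 'g \<Rightarrow>\<^sub>0 int) set \<Rightarrow> complex))" where
  "attached_data S m R = (THE d. has_data S m R d)"

end

end

theory Submission
  imports Defs
begin

text \<open>In an IR-representation with basis \<open>\<alpha>\<close> every \<open>s \<in> S\<close> acts by \<open>s \<alpha>\<^sub>t = \<alpha>\<^sub>t + c\<^sub>s\<^sub>t \<alpha>\<^sub>s\<close> with \<open>c\<^sub>s\<^sub>s = -2\<close>,
  so the representation is encoded by the matrix \<open>c\<close>. The basis is unique up to rescaling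
  \<open>\<alpha>\<^sub>s \<mapsto> x\<^sub>s \<alpha>\<^sub>s\<close>, because \<open>\<alpha>\<^sub>s\<close> spans the \<open>-1\<close>-eigenspace of \<open>s\<close>; hence isomorphism classes are the
  matrices \<open>c\<close> modulo the gauge action \<open>c\<^sub>s\<^sub>t \<mapsto> c\<^sub>s\<^sub>t x\<^sub>t / x\<^sub>s\<close>.

  The relation \<open>(rt)\<^sup>m = 1\<close> only constrains the action on the plane spanned by \<open>\<alpha>\<^sub>r, \<alpha>\<^sub>t\<close>, where \<open>rt\<close> has
  determinant \<open>1\<close> and trace \<open>c\<^sub>r\<^sub>t c\<^sub>t\<^sub>r - 2\<close>. It holds iff \<open>c\<^sub>r\<^sub>t c\<^sub>t\<^sub>r = 4 cos\<^sup>2 (k \<pi> / m)\<close> for some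
  \<open>1 \<le> k \<le> m / 2\<close>, with \<open>c\<^sub>r\<^sub>t = c\<^sub>t\<^sub>r = 0\<close> when the cosine vanishes.

  For fixed exponents \<open>k\<close>, what remains of \<open>c\<close> is the 1-cochain \<open>f (r, t) = 2 cos (k\<^sub>r\<^sub>t \<pi> / m\<^sub>r\<^sub>t) / c\<^sub>r\<^sub>t\<close> on the
  graph, and the gauge action multiplies it by coboundaries. Two cochains differ by a coboundary
  iff they agree on cycles, and every character of the cycle group extends to a cochain.\<close>

section \<open>Chains, cycles and characters of a graph\<close>

lemma complex_units_simps [simp]:
  "carrier complex_units = UNIV - {0}" "x \<otimes>\<^bsub>complex_units\<^esub> y = x * y" "\<one>\<^bsub>complex_units\<^esub> = 1"
  by (auto simp: complex_units_def)

lemma comm_group_complex_units: "comm_group complex_units"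
proof (rule comm_groupI)
  show "\<exists>y\<in>carrier complex_units. y \<otimes>\<^bsub>complex_units\<^esub> x = \<one>\<^bsub>complex_units\<^esub>"
    if "x \<in> carrier complex_units" for x
    using that by (intro bexI[of _ "inverse x"]) auto
qed auto

lemma keys_add_subset:
  "Poly_Mapping.keys a \<subseteq> A \<Longrightarrow> Poly_Mapping.keys b \<subseteq> A \<Longrightarrow> Poly_Mapping.keys (a + b) \<subseteq> A"
  using keys_add[of a b] by blast

lemma keys_diff_subset:
  "Poly_Mapping.keys a \<subseteq> A \<Longrightarrow> Poly_Mapping.keys b \<subseteq> A \<Longrightarrow> Poly_Mapping.keys (a - b) \<subseteq> A"
  using keys_diff[of a b] by blast

lemma free_abelian_induct [consumes 1, case_names zero diff generator]:
  assumes "Poly_Mapping.keys c \<subseteq> A" "P 0"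
    and "\<And>a b. \<lbrakk>Poly_Mapping.keys a \<subseteq> A; Poly_Mapping.keys b \<subseteq> A; P a; P b\<rbrakk> \<Longrightarrow> P (a - b)"
    and "\<And>x. x \<in> A \<Longrightarrow> P (frag_of x)"
  shows "P c"
  using assms by (rule free_Abelian_group_induct)

lemma hom_free_units:
  assumes "F \<in> hom (free_Abelian_group A) complex_units"
  shows hom_free_units_nonzero: "\<And>a. Poly_Mapping.keys a \<subseteq> A \<Longrightarrow> F a \<noteq> 0"
    and hom_free_units_zero: "F 0 = 1"
    and hom_free_units_add: "\<And>a b. \<lbrakk>Poly_Mapping.keys a \<subseteq> A; Poly_Mapping.keys b \<subseteq> A\<rbrakk>
          \<Longrightarrow> F (a + b) = F a * F b"
    and hom_free_units_diff: "\<And>a b. \<lbrakk>Poly_Mapping.keys a \<subseteq> A; Poly_Mapping.keys b \<subseteq> A\<rbrakk>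
          \<Longrightarrow> F (a - b) = F a / F b"
proof -
  show nz: "F a \<noteq> 0" if "Poly_Mapping.keys a \<subseteq> A" for a
    using hom_in_carrier[OF assms, of a] that by simp
  show add: "F (a + b) = F a * F b" if "Poly_Mapping.keys a \<subseteq> A" "Poly_Mapping.keys b \<subseteq> A" for a b
    using hom_mult[OF assms, of a b] that by simp
  show "F 0 = 1"
    using add[of 0 0] nz[of 0] by simp
  show "F (a - b) = F a / F b" if "Poly_Mapping.keys a \<subseteq> A" "Poly_Mapping.keys b \<subseteq> A" for a b
    using add[of "a - b" b] nz[of b] that keys_diff_subset[OF that] by (simp add: field_simps)
qed

lemma hom_free_units_eqI:
  assumes "F \<in> hom (free_Abelian_group A) complex_units" "G \<in> hom (free_Abelian_group A) complex_units"
    and "\<And>a. a \<in> A \<Longrightarrow> F (frag_of a) = G (frag_of a)" and "Poly_Mapping.keys c \<subseteq> A"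
  shows "F c = G c"
  using assms(4)
  by (rule free_Abelian_group_induct)
     (simp_all add: hom_free_units_zero[OF assms(1)] hom_free_units_zero[OF assms(2)]
        hom_free_units_diff[OF assms(1)] hom_free_units_diff[OF assms(2)] assms(3))

text \<open>Representative-level form of \<open>boundary\<close>. Since \<open>boundary\<close> goes
  through \<open>the_elem\<close> of an image of a coset, all computations are made here and carried
  over by \<open>boundary_cls\<close>.\<close>

definition chain_boundary :: "('v \<times> 'v \<Rightarrow>\<^sub>0 int) \<Rightarrow> ('v \<Rightarrow>\<^sub>0 int)" where
  "chain_boundary = frag_extend (\<lambda>(r, t). frag_of t - frag_of r)"

lemma chain_boundary_simps [simp]:
  "chain_boundary 0 = 0" "chain_boundary (a + b) = chain_boundary a + chain_boundary b" "chain_boundary (a - b) = chain_boundary a - chain_boundary b" "chain_boundary (- a) = - chain_boundary a"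
  "chain_boundary (frag_of (r, t)) = frag_of t - frag_of r"
  by (simp_all add: chain_boundary_def frag_extend_add frag_extend_diff frag_extend_minus)

section \<open>Chains modulo edge reversal, and cycles\<close>

locale symmetric_edges =
  fixes S :: "'v set" and E :: "('v \<times> 'v) set"
  assumes edges: "E \<subseteq> S \<times> S" and sym: "sym E"
begin

abbreviation chain_class :: "('v \<times> 'v \<Rightarrow>\<^sub>0 int) \<Rightarrow> ('v \<times> 'v \<Rightarrow>\<^sub>0 int) set" where
  "chain_class c \<equiv> reversal_relations E #>\<^bsub>free_Abelian_group E\<^esub> c"

lemma keys_chain_boundary: "Poly_Mapping.keys c \<subseteq> E \<Longrightarrow> Poly_Mapping.keys (chain_boundary c) \<subseteq> S"
proof (induction c rule: free_abelian_induct)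
  case (generator a)
  then show ?case
    using edges keys_diff[of "frag_of (snd a)" "frag_of (fst a)"] by (cases a) auto
qed (auto simp: keys_diff_subset)

lemma reversed: "(r, t) \<in> E \<Longrightarrow> (t, r) \<in> E"
  using sym by (auto dest: symD)

lemma keys_relator: "(r, t) \<in> E \<Longrightarrow> Poly_Mapping.keys (frag_of (r, t) + frag_of (t, r)) \<subseteq> E"
  by (intro keys_add_subset) (auto intro: reversed)

lemma relators_in_carrier:
  "{frag_of (r, t) + frag_of (t, r) | r t. (r, t) \<in> E} \<subseteq> carrier (free_Abelian_group E)"
  using keys_relator by (simp only: subset_iff carrier_free_Abelian_group_iff mem_Collect_eq) blast

lemma subgroup_relations: "subgroup (reversal_relations E) (free_Abelian_group E)"
  unfolding reversal_relations_def
  by (rule group.generate_is_subgroup[OF group_free_Abelian_group relators_in_carrier])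

lemma normal_relations: "reversal_relations E \<lhd> free_Abelian_group E"
  by (rule comm_group.subgroup_imp_normal[OF abelian_free_Abelian_group subgroup_relations])

lemma chain_class_hom: "chain_class \<in> hom (free_Abelian_group E) (chains1 E)"
  unfolding chains1_def by (rule normal.r_coset_hom_Mod[OF normal_relations])

lemma chain_class_add:
  "\<lbrakk>Poly_Mapping.keys a \<subseteq> E; Poly_Mapping.keys b \<subseteq> E\<rbrakk> \<Longrightarrow> chain_class (a + b) = chain_class a \<otimes>\<^bsub>chains1 E\<^esub> chain_class b"
  using hom_mult[OF chain_class_hom, of a b] by simp

lemma chains1_cases:
  assumes "x \<in> carrier (chains1 E)"
  obtains c where "Poly_Mapping.keys c \<subseteq> E" "x = chain_class c"
  using assms by (auto simp: chains1_def carrier_FactGroup)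

lemma chain_class_in_chains1: "Poly_Mapping.keys c \<subseteq> E \<Longrightarrow> chain_class c \<in> carrier (chains1 E)"
  using hom_in_carrier[OF chain_class_hom] by simp

text \<open>The criterion for \<open>F\<close> to descend to \<open>chains1 E\<close>. The bound on
  the keys is carried through the induction because \<open>F\<close> is known to be multiplicative
  only on chains supported in \<open>E\<close>.\<close>

lemma relations_trivial:
  assumes "F \<in> hom (free_Abelian_group E) complex_units"
    and "\<And>r t. (r, t) \<in> E \<Longrightarrow> F (frag_of (r, t)) * F (frag_of (t, r)) = 1"
    and "c \<in> reversal_relations E"
  shows "Poly_Mapping.keys c \<subseteq> E \<and> F c = 1"
  using assms(3) unfolding reversal_relations_def
proof (induction rule: generate.induct)
  case one
  then show ?case
    by (simp add: hom_free_units_zero[OF assms(1)])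
next
  case (incl h)
  then obtain r t where h: "h = frag_of (r, t) + frag_of (t, r)" "(r, t) \<in> E"
    by auto
  have "Poly_Mapping.keys h \<subseteq> E"
    using h keys_relator by blast
  then show ?case
    using h assms(2) by (simp add: hom_free_units_add[OF assms(1)] reversed)
next
  case (inv h)
  then obtain r t where h: "h = frag_of (r, t) + frag_of (t, r)" "(r, t) \<in> E"
    by auto
  have k: "Poly_Mapping.keys h \<subseteq> E"
    using h keys_relator by blast
  have "F (0 - h) = 1"
    using h assms(2) k hom_free_units_diff[OF assms(1), of 0 h]
    by (simp add: hom_free_units_add[OF assms(1)] hom_free_units_zero[OF assms(1)] reversed)
  then show ?case
    using k by simp
next
  case (eng h1 h2)
  then show ?case
    by (simp add: hom_free_units_add[OF assms(1)] keys_add_subset)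
qed

lemma chain_boundary_relations: "c \<in> reversal_relations E \<Longrightarrow> Poly_Mapping.keys c \<subseteq> E \<and> chain_boundary c = 0"
  unfolding reversal_relations_def
proof (induction rule: generate.induct)
  case (incl h)
  then obtain r t where h: "h = frag_of (r, t) + frag_of (t, r)" "(r, t) \<in> E"
    by auto
  then have "Poly_Mapping.keys h \<subseteq> E"
    using keys_relator by blast
  with h show ?case
    by simp
next
  case (inv h)
  then obtain r t where h: "h = frag_of (r, t) + frag_of (t, r)" "(r, t) \<in> E"
    by auto
  then have "Poly_Mapping.keys h \<subseteq> E"
    using keys_relator by blast
  moreover have "chain_boundary h = 0"
    using h by simp
  ultimately show ?case
    by simp
qed (auto simp: keys_add_subset)

text \<open>Members of one coset differ by relations, which have boundary zero, so the image in the
  definition of \<open>boundary\<close> is a singleton.\<close>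

lemma boundary_cls:
  assumes "Poly_Mapping.keys c \<subseteq> E"
  shows "boundary (chain_class c) = chain_boundary c"
proof -
  have "chain_boundary ` chain_class c = {chain_boundary c}"
    using chain_boundary_relations subgroup.one_closed[OF subgroup_relations]
    by (fastforce simp: r_coset_def image_iff)
  then show ?thesis
    by (simp add: boundary_def chain_boundary_def)
qed

lemma chain_class_in_H1_iff:
  assumes "Poly_Mapping.keys c \<subseteq> E"
  shows "chain_class c \<in> carrier (H1 S E) \<longleftrightarrow> chain_boundary c = 0"
  using assms by (simp add: H1_def kernel_def boundary_cls chain_class_in_chains1)

lemma H1_cases:
  assumes "x \<in> carrier (H1 S E)"
  obtains c where "Poly_Mapping.keys c \<subseteq> E" "x = chain_class c" "chain_boundary c = 0"
proof -
  have "x \<in> carrier (chains1 E)"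
    using assms by (simp add: H1_def kernel_def)
  then obtain c where "Poly_Mapping.keys c \<subseteq> E" "x = chain_class c"
    by (rule chains1_cases)
  then show thesis
    using that assms chain_class_in_H1_iff by blast
qed

lemma mult_H1: "x \<otimes>\<^bsub>H1 S E\<^esub> y = x \<otimes>\<^bsub>chains1 E\<^esub> y"
  by (simp add: H1_def)

lemma hom_cls:
  "f \<in> hom (chains1 E) complex_units \<Longrightarrow> (\<lambda>c. f (chain_class c)) \<in> hom (free_Abelian_group E) complex_units"
  using hom_compose[OF chain_class_hom] by (simp add: comp_def)

text \<open>The relator of an edge represents the zero class. This mirrors the fact that
  \<open>a t r / a r t\<close> is inverted when \<open>r\<close> and \<open>t\<close> are
  swapped.\<close>

lemma hom_edge_chain_reverse:
  assumes "f \<in> hom (chains1 E) complex_units" "(r, t) \<in> E"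
  shows "f (edge_chain E r t) * f (edge_chain E t r) = 1"
proof -
  have "frag_of (r, t) + frag_of (t, r) \<in> reversal_relations E"
    unfolding reversal_relations_def using assms(2) by (auto intro: generate.incl)
  then have "chain_class (frag_of (r, t) + frag_of (t, r)) = reversal_relations E"
    by (rule subgroup.rcos_const[OF subgroup_relations group_free_Abelian_group])
  also have "\<dots> = chain_class 0"
    using subgroup.rcos_const[OF subgroup_relations group_free_Abelian_group, of 0]
      subgroup.one_closed[OF subgroup_relations] by simp
  finally have "f (chain_class (frag_of (r, t) + frag_of (t, r))) = 1"
    using hom_free_units_zero[OF hom_cls[OF assms(1)]] by simp
  then show ?thesis
    using assms(2) hom_free_units_add[OF hom_cls[OF assms(1)], of "frag_of (r, t)" "frag_of (t, r)"]
    by (simp add: edge_chain_def reversed)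
qed

lemma hom_restrict_H1:
  assumes "f \<in> hom (chains1 E) complex_units"
  shows "restrict f (carrier (H1 S E)) \<in> characters (H1 S E)"
proof -
  have "x \<otimes>\<^bsub>chains1 E\<^esub> y \<in> carrier (H1 S E) \<and> f (x \<otimes>\<^bsub>chains1 E\<^esub> y) = f x * f y"
    if xy: "x \<in> carrier (H1 S E)" "y \<in> carrier (H1 S E)" for x y
  proof -
    obtain a b where ab: "Poly_Mapping.keys a \<subseteq> E" "x = chain_class a" "chain_boundary a = 0"
        "Poly_Mapping.keys b \<subseteq> E" "y = chain_class b" "chain_boundary b = 0"
      using xy by (meson H1_cases)
    then have "x \<otimes>\<^bsub>chains1 E\<^esub> y = chain_class (a + b)"
      by (simp add: chain_class_add)
    moreover have "chain_class (a + b) \<in> carrier (H1 S E)"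
      using ab by (simp add: chain_class_in_H1_iff keys_add_subset)
    ultimately show ?thesis
      using ab hom_mult[OF assms, of x y] by (simp add: chain_class_in_chains1)
  qed
  moreover have "f x \<noteq> 0" if "x \<in> carrier (H1 S E)" for x
  proof -
    have "x \<in> carrier (chains1 E)"
      using that by (simp add: H1_def kernel_def)
    then show ?thesis
      using hom_in_carrier[OF assms, of x] by simp
  qed
  ultimately show ?thesis
    by (auto simp: characters_def hom_def mult_H1)
qed

text \<open>Converse of \<open>hom_edge_chain_reverse\<close>: values on oriented edges always
  extend to the free abelian group, and the hypothesis kills the relators, so the extension factors
  through the quotient.\<close>

lemma edge_function_extends:
  assumes "\<And>r t. (r, t) \<in> E \<Longrightarrow> g r t * g t r = (1 :: complex)"
  obtains f where "f \<in> hom (chains1 E) complex_units"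
    "\<And>r t. (r, t) \<in> E \<Longrightarrow> f (edge_chain E r t) = g r t"
proof -
  interpret U: comm_group complex_units
    by (rule comm_group_complex_units)
  have "(\<lambda>(r, t). g r t) ` E \<subseteq> carrier complex_units"
  proof -
    have "g r t \<noteq> 0" if "(r, t) \<in> E" for r t
      using assms[OF that] by auto
    then show ?thesis
      by auto
  qed
  then obtain F where F: "F \<in> hom (free_Abelian_group E) complex_units"
    "\<And>x. x \<in> E \<Longrightarrow> F (frag_of x) = (\<lambda>(r, t). g r t) x"
    by (rule U.free_Abelian_group_universal) auto
  have "F x = F y" if xy: "x \<in> carrier (free_Abelian_group E)" "y \<in> carrier (free_Abelian_group E)"
    "chain_class x = chain_class y" for x y
  proof -
    have "x \<in> chain_class y"
      unfolding xy(3)[symmetric] using subgroup.one_closed[OF subgroup_relations]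
      by (force simp: r_coset_def)
    then obtain n where "n \<in> reversal_relations E" "x = n + y"
      by (auto simp: r_coset_def)
    then show ?thesis
      using relations_trivial[OF F(1), of n] F(2) assms reversed xy hom_free_units_add[OF F(1), of n y]
      by auto
  qed
  then obtain f where f: "f \<in> hom (free_Abelian_group E Mod reversal_relations E) complex_units"
    "\<And>x. x \<in> carrier (free_Abelian_group E) \<Longrightarrow> f (chain_class x) = F x"
    using FactGroup_universal[OF F(1) normal_relations] by metis
  show thesis
    by (rule that[of f]) (use f F in \<open>auto simp: chains1_def edge_chain_def\<close>)
qed

text \<open>Fixing a base point in every component and a path from it to each vertex splits the
  inclusion of the cycles into the chains, via \<open>c \<mapsto> c - P (\<partial>c)\<close>.\<close>

lemma paths_from_base_points:
  obtains root P where
    "\<And>v. Poly_Mapping.keys (P v) \<subseteq> E" "\<And>v. chain_boundary (P v) = frag_of v - frag_of (root v)"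
    "\<And>r t. (r, t) \<in> E \<Longrightarrow> root r = root t"
proof -
  \<comment> \<open>The choice depends only on the set of vertices reachable from \<open>v\<close>.
    As \<open>E\<close> is symmetric, adjacent vertices have the same reachable set, hence literally
    the same \<open>SOME\<close>.\<close>
  define root where "root v = (SOME u. (v, u) \<in> E\<^sup>*)" for v
  have root: "(v, root v) \<in> E\<^sup>*" for v
    unfolding root_def by (rule someI[of _ v]) simp
  have "\<exists>p. Poly_Mapping.keys p \<subseteq> E \<and> chain_boundary p = frag_of v - frag_of u" if "(v, u) \<in> E\<^sup>*" for u v
    using that
  proof (induction rule: rtrancl_induct)
    case base
    then show ?case
      by (intro exI[of _ 0]) simp
  next
    case (step y z)
    then obtain p where p: "Poly_Mapping.keys p \<subseteq> E" "chain_boundary p = frag_of v - frag_of y"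
      by blast
    \<comment> \<open>The new edge is traversed backwards: \<open>(z, y)\<close> has boundary
      \<open>y - z\<close>, so the sum telescopes to \<open>v - z\<close>.\<close>
    have "Poly_Mapping.keys (p + frag_of (z, y)) \<subseteq> E"
      by (rule keys_add_subset[OF p(1)]) (simp add: step reversed)
    moreover have "chain_boundary (p + frag_of (z, y)) = frag_of v - frag_of z"
      by (simp add: p)
    ultimately show ?case
      by blast
  qed
  then have "\<forall>v. \<exists>p. Poly_Mapping.keys p \<subseteq> E \<and> chain_boundary p = frag_of v - frag_of (root v)"
    using root by blast
  then have "\<exists>P. \<forall>v. Poly_Mapping.keys (P v) \<subseteq> E \<and> chain_boundary (P v) = frag_of v - frag_of (root v)"
    by (rule choice)
  moreover have "root r = root t" if "(r, t) \<in> E" for r t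
  proof -
    have "(r, u) \<in> E\<^sup>* \<longleftrightarrow> (t, u) \<in> E\<^sup>*" for u
      using that reversed[OF that] by (meson converse_rtrancl_into_rtrancl)
    then show ?thesis
      by (simp add: root_def)
  qed
  ultimately show thesis
    using that by blast
qed

text \<open>Precomposing \<chi> with the retraction of chains onto cycles gives a homomorphism on
  all chains. Cycles are left unchanged by the retraction, so its restriction is \<chi>
  again.\<close>

lemma character_extends:
  assumes "\<chi> \<in> characters (H1 S E)"
  obtains f where "f \<in> hom (chains1 E) complex_units" "\<chi> = restrict f (carrier (H1 S E))"
proof -
  obtain root P where P: "\<And>v. Poly_Mapping.keys (P v) \<subseteq> E"
    "\<And>v. chain_boundary (P v) = frag_of v - frag_of (root v)" and root: "\<And>r t. (r, t) \<in> E \<Longrightarrow> root r = root t"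
    by (rule paths_from_base_points) blast
  have \<chi>_add: "\<chi> (chain_class (a + b)) = \<chi> (chain_class a) * \<chi> (chain_class b)"
    if "Poly_Mapping.keys a \<subseteq> E" "chain_boundary a = 0" "Poly_Mapping.keys b \<subseteq> E" "chain_boundary b = 0" for a b
    using assms hom_mult[of \<chi> "H1 S E" complex_units "chain_class a" "chain_class b"] that
    by (simp add: characters_def mult_H1 chain_class_add chain_class_in_H1_iff)
  have \<chi>_nonzero: "\<chi> (chain_class a) \<noteq> 0" if "Poly_Mapping.keys a \<subseteq> E" "chain_boundary a = 0" for a
    using assms hom_in_carrier[of \<chi> "H1 S E" complex_units "chain_class a"] that
    by (simp add: characters_def chain_class_in_H1_iff)
  have proj_keys: "Poly_Mapping.keys (c - frag_extend P (chain_boundary c)) \<subseteq> E" if "Poly_Mapping.keys c \<subseteq> E" for c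
    using that keys_frag_extend[of P "chain_boundary c"] P(1) by (intro keys_diff_subset) blast+
  have chain_boundary_proj: "chain_boundary (c - frag_extend P (chain_boundary c)) = 0" if "Poly_Mapping.keys c \<subseteq> E" for c
    using that
  proof (induction c rule: free_abelian_induct)
    \<comment> \<open>For an edge \<open>(r, t)\<close> the corrected chain has boundary
      \<open>root t - root r\<close>, which vanishes because adjacent vertices share their
      root.\<close>
    case (generator a)
    then show ?case
      using root by (cases a) (simp add: frag_extend_diff P)
  qed (simp_all add: frag_extend_diff)
  define F where "F c = \<chi> (chain_class (c - frag_extend P (chain_boundary c)))" for c
  have F: "F \<in> hom (free_Abelian_group E) complex_units"
  proof (rule homI)
    fix a b
    assume ab: "a \<in> carrier (free_Abelian_group E)" "b \<in> carrier (free_Abelian_group E)"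
    have "(a + b) - frag_extend P (chain_boundary (a + b))
        = (a - frag_extend P (chain_boundary a)) + (b - frag_extend P (chain_boundary b))"
      by (simp add: frag_extend_add)
    then show "F (a \<otimes>\<^bsub>free_Abelian_group E\<^esub> b) = F a \<otimes>\<^bsub>complex_units\<^esub> F b"
      using ab unfolding F_def
      by (simp only: mult_free_Abelian_group complex_units_simps) (intro \<chi>_add proj_keys chain_boundary_proj; simp)
  next
    show "F a \<in> carrier complex_units" if "a \<in> carrier (free_Abelian_group E)" for a
      using that \<chi>_nonzero[OF proj_keys chain_boundary_proj, of a] by (simp add: F_def)
  qed
  have F_cycle: "F c = \<chi> (chain_class c)" if "chain_boundary c = 0" for c
    using that by (simp add: F_def)
  have "F (frag_of (r, t)) * F (frag_of (t, r)) = 1" if "(r, t) \<in> E" for r t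
  proof -
    let ?c = "frag_of (r, t) + frag_of (t, r)"
    have "?c \<in> reversal_relations E"
      unfolding reversal_relations_def using that by (auto intro: generate.incl)
    then have "chain_class ?c = chain_class 0"
      using subgroup.rcos_const[OF subgroup_relations group_free_Abelian_group]
        subgroup.one_closed[OF subgroup_relations] by (metis one_free_Abelian_group)
    then have "F ?c = F 0"
      by (simp add: F_cycle)
    then show ?thesis
      using that by (simp add: hom_free_units_add[OF F] hom_free_units_zero[OF F] reversed)
  qed
  then obtain f where f: "f \<in> hom (chains1 E) complex_units"
    "\<And>r t. (r, t) \<in> E \<Longrightarrow> f (edge_chain E r t) = F (frag_of (r, t))"
    using edge_function_extends[of "\<lambda>r t. F (frag_of (r, t))"] by metis
  have "f (chain_class c) = F c" if "Poly_Mapping.keys c \<subseteq> E" for c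
    using hom_free_units_eqI[OF hom_cls[OF f(1)] F _ that] f(2) by (auto simp: edge_chain_def)
  then have "\<chi> x = f x" if "x \<in> carrier (H1 S E)" for x
    using that by (metis F_cycle H1_cases)
  then have "\<chi> = restrict f (carrier (H1 S E))"
    using assms by (auto simp: characters_def extensional_def)
  with f(1) show thesis
    by (rule that)
qed

text \<open>The factor \<open>x r / x t\<close> is a coboundary. Comparing \<open>f\<close> and
  \<open>f'\<close> along the paths from the base points produces the potential \<open>x\<close>;
  conversely a coboundary takes the value 1 on every cycle.\<close>

lemma restrict_H1_eq_iff:
  assumes f: "f \<in> hom (chains1 E) complex_units" and f': "f' \<in> hom (chains1 E) complex_units"
  shows "restrict f (carrier (H1 S E)) = restrict f' (carrier (H1 S E)) \<longleftrightarrow>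
    (\<exists>x. (\<forall>v. x v \<noteq> 0) \<and> (\<forall>(r, t) \<in> E. f' (edge_chain E r t) = f (edge_chain E r t) * (x r / x t)))"
    (is "?L \<longleftrightarrow> ?R")
proof
  assume ?L
  then have eq: "f (chain_class c) = f' (chain_class c)" if "Poly_Mapping.keys c \<subseteq> E" "chain_boundary c = 0" for c
    using chain_class_in_H1_iff[OF that(1)] that(2) by (metis restrict_apply')
  obtain root P where P: "\<And>v. Poly_Mapping.keys (P v) \<subseteq> E"
    "\<And>v. chain_boundary (P v) = frag_of v - frag_of (root v)" and root: "\<And>r t. (r, t) \<in> E \<Longrightarrow> root r = root t"
    by (rule paths_from_base_points) blast
  note nz = hom_free_units_nonzero[OF hom_cls[OF f] P(1)] hom_free_units_nonzero[OF hom_cls[OF f'] P(1)]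
  show ?R
  \<comment> \<open>The witness stays schematic and is fixed by the goals that follow: the potential
    at \<open>v\<close> is the ratio of \<open>f\<close> to \<open>f'\<close> on the path
    \<open>P v\<close>.\<close>
  proof (intro exI conjI allI ballI; clarify?)
    show "f (chain_class (P v)) / f' (chain_class (P v)) = 0 \<Longrightarrow> False" for v
      using nz[of v] by simp
    fix r t assume rt: "(r, t) \<in> E"
    \<comment> \<open>\<open>?c\<close> is a closed loop: from the root to \<open>r\<close>, along
      the edge to \<open>t\<close>, and back to the root.\<close>
    let ?e = "frag_of (r, t)" and ?c = "frag_of (r, t) - P t + P r"
    have k: "Poly_Mapping.keys ?e \<subseteq> E" "Poly_Mapping.keys (?e - P t) \<subseteq> E" "Poly_Mapping.keys ?c \<subseteq> E"
    proof -
      show k1: "Poly_Mapping.keys ?e \<subseteq> E"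
        using rt by simp
      show k2: "Poly_Mapping.keys (?e - P t) \<subseteq> E"
        by (intro keys_diff_subset k1 P)
      show "Poly_Mapping.keys ?c \<subseteq> E"
        by (intro keys_add_subset k2 P)
    qed
    have "f (chain_class ?c) = f' (chain_class ?c)"
      using root[OF rt] by (intro eq k) (simp add: P)
    then have "f (chain_class ?e) / f (chain_class (P t)) * f (chain_class (P r)) = f' (chain_class ?e) / f' (chain_class (P t)) * f' (chain_class (P r))"
      using k P(1)
      by (simp add: hom_free_units_add[OF hom_cls[OF f]] hom_free_units_add[OF hom_cls[OF f']]
          hom_free_units_diff[OF hom_cls[OF f]] hom_free_units_diff[OF hom_cls[OF f']])
    then show "f' (edge_chain E r t) = f (edge_chain E r t) *
        (f (chain_class (P r)) / f' (chain_class (P r)) / (f (chain_class (P t)) / f' (chain_class (P t))))"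
      using nz[of r] nz[of t] by (simp add: edge_chain_def field_simps)
  qed
next
  assume ?R
  then obtain x where x: "\<And>v. x v \<noteq> 0"
    and fx: "\<And>r t. (r, t) \<in> E \<Longrightarrow> f' (edge_chain E r t) = f (edge_chain E r t) * (x r / x t)"
    by blast
  interpret U: comm_group complex_units
    by (rule comm_group_complex_units)
  have "(\<lambda>v. 1 / x v) ` S \<subseteq> carrier complex_units"
    using x by auto
  then obtain h where h: "h \<in> hom (free_Abelian_group S) complex_units"
    "\<And>v. v \<in> S \<Longrightarrow> h (frag_of v) = 1 / x v"
    by (rule U.free_Abelian_group_universal) auto
  \<comment> \<open>The inverse in \<open>h\<close> is chosen so that
    \<open>h (frag_of t - frag_of r) = x r / x t\<close>. On a cycle the correction factor is
    \<open>h 0 = 1\<close>.\<close>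
  have "f' (chain_class c) = f (chain_class c) * h (chain_boundary c)" if "Poly_Mapping.keys c \<subseteq> E" for c
    using that
  proof (induction c rule: free_abelian_induct)
    case zero
    show ?case
      using hom_free_units_zero[OF hom_cls[OF f]] hom_free_units_zero[OF hom_cls[OF f']]
        hom_free_units_zero[OF h(1)] by simp
  next
    case (diff a b)
    then show ?case
      by (simp add: hom_free_units_diff[OF hom_cls[OF f]] hom_free_units_diff[OF hom_cls[OF f']]
          hom_free_units_diff[OF h(1)] keys_chain_boundary)
  next
    case (generator a)
    then obtain r t where a: "a = (r, t)" "(r, t) \<in> E"
      by (cases a) auto
    then have "r \<in> S" "t \<in> S"
      using edges by auto
    then show ?case
      using fx[OF a(2)] h(2) a hom_free_units_diff[OF h(1), of "frag_of t" "frag_of r"]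
      by (simp add: edge_chain_def)
  qed
  then have "f' x = f x" if "x \<in> carrier (H1 S E)" for x
    using that hom_free_units_zero[OF h(1)] by (metis H1_cases mult.right_neutral)
  then show ?L
    by (auto intro!: restrict_ext)
qed

end

section \<open>Products of two reflections in a plane\<close>

definition two_cos :: "nat \<Rightarrow> nat \<Rightarrow> complex" where
  "two_cos m k = complex_of_real (2 * cos (real k * pi / real m))"

text \<open>Places the angle in the half-open interval from 0 (excluded) to \<open>pi / 2\<close>,
  where the cosine is nonnegative and injective.\<close>

lemma angle_bounds:
  assumes "1 \<le> k" "2 * k \<le> m"
  shows "0 < real k * pi / real m" "real k * pi / real m \<le> pi / 2"
proof -
  have "real k * 2 \<le> real m"
    using assms(2) by linarith
  then show "real k * pi / real m \<le> pi / 2"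
    using assms by (simp add: divide_simps)
qed (use assms in simp)

lemma two_cos_eq_0_iff:
  assumes "1 \<le> k" "2 * k \<le> m"
  shows "two_cos m k = 0 \<longleftrightarrow> 2 * k = m"
proof -
  let ?x = "real k * pi / real m"
  note b = angle_bounds[OF assms]
  have "cos ?x = 0 \<longleftrightarrow> ?x = pi / 2"
  proof
    assume "cos ?x = 0"
    moreover have "cos ?x > 0" if "?x < pi / 2"
      using b that by (intro cos_gt_zero) auto
    ultimately show "?x = pi / 2"
      using b by fastforce
  qed (simp only: cos_pi_half)
  also have "\<dots> \<longleftrightarrow> real (2 * k) = real m"
    using assms by (auto simp: field_simps)
  finally show ?thesis
    unfolding two_cos_def of_nat_eq_iff by simp
qed

text \<open>Recovers the exponent \<open>k\<close> from the product \<open>c r t * c t r\<close>: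
  the cosines are nonnegative, so the square determines them, and the cosine is injective on the
  angles that occur.\<close>

lemma two_cos_power2_inj:
  assumes "1 \<le> k" "2 * k \<le> m" "1 \<le> l" "2 * l \<le> m" "(two_cos m k)\<^sup>2 = (two_cos m l)\<^sup>2"
  shows "k = l"
proof -
  let ?x = "real k * pi / real m" and ?y = "real l * pi / real m"
  note b = angle_bounds[OF assms(1,2)] angle_bounds[OF assms(3,4)]
  have "(2 * cos ?x)\<^sup>2 = (2 * cos ?y)\<^sup>2"
    using assms(5) unfolding two_cos_def of_real_power[symmetric] of_real_eq_iff .
  moreover have "0 \<le> cos ?x" "0 \<le> cos ?y"
    using b by (intro cos_ge_zero; linarith)+
  ultimately have "cos ?x = cos ?y"
    by (simp add: power2_eq_iff_nonneg)
  then have "?x = ?y"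
    by (rule cos_inj_pi[rotated -1]) (use b pi_gt_zero in linarith)+
  then show ?thesis
    using assms by (auto simp: field_simps)
qed

text \<open>Equality would force the sine of the angle to vanish. The bound keeps the two
  eigenvalues of \<open>rt\<close> apart from 1, and makes \<open>4 - c r t * c t r\<close>
  invertible when fixed vectors are sought.\<close>

lemma two_cos_power2_neq_4:
  assumes "1 \<le> k" "2 * k \<le> m"
  shows "(two_cos m k)\<^sup>2 \<noteq> 4"
proof
  let ?x = "real k * pi / real m"
  note b = angle_bounds[OF assms]
  assume "(two_cos m k)\<^sup>2 = 4"
  then have "complex_of_real ((2 * cos ?x)\<^sup>2) = complex_of_real 4"
    by (simp add: two_cos_def)
  then have "(cos ?x)\<^sup>2 = 1"
    unfolding of_real_eq_iff by (simp add: power_mult_distrib)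
  then have "(sin ?x)\<^sup>2 = 0"
    using sin_cos_squared_add[of ?x] by simp
  moreover have "sin ?x > 0"
    using b pi_gt_zero by (intro sin_gt_zero) linarith+
  ultimately show False
    by simp
qed

text \<open>Writing \<open>m = g * q\<close> with \<open>g = gcd m k\<close>, the bounds
  \<open>g \<le> k\<close> and \<open>2 * k \<le> m\<close> exclude \<open>q = 1\<close>, and
  \<open>q = 2\<close> squeezes \<open>k\<close> to \<open>g\<close>, half of \<open>m\<close>.
  Together with \<open>two_cos_eq_0_iff\<close>, the edges become the pairs with nonzero
  cosine.\<close>

lemma three_le_reduced_order_iff:
  fixes m k :: nat
  assumes "1 \<le> k" "2 * k \<le> m"
  shows "3 \<le> m div gcd m k \<longleftrightarrow> 2 * k \<noteq> m"
proof
  assume "3 \<le> m div gcd m k"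
  then show "2 * k \<noteq> m"
    using assms by auto
next
  assume ne: "2 * k \<noteq> m"
  define g where "g = gcd m k"
  obtain q where q: "m = g * q"
    unfolding g_def by (meson dvdE gcd_dvd1)
  have g: "0 < g" "g \<le> k"
    using assms by (auto simp: g_def intro!: gcd_le2_nat)
  have "q \<noteq> 0" "q \<noteq> 1"
    using q g assms by (auto intro: ccontr)
  moreover have "q \<noteq> 2"
    using q g ne assms by auto
  ultimately have "3 \<le> q"
    by linarith
  moreover have "m div g = q"
    using q g by simp
  ultimately show "3 \<le> m div gcd m k"
    by (simp add: g_def)
qed

text \<open>A half-angle formula: for \<open>l = cis (2 * x)\<close> the left side is
  \<open>2 * cos (2 * x) + 2\<close>, which is the square of \<open>2 * cos x\<close>.\<close>

lemma root_of_unity_trace: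
  assumes "0 < m" "l ^ m = 1" "l \<noteq> 1"
  obtains k where "1 \<le> k" "2 * k \<le> m" "l + inverse l + 2 = (two_cos m k)\<^sup>2"
proof -
  obtain j where j: "j < m" "l = cis (2 * pi * real j / real m)"
    using assms(2) bij_betw_roots_unity[OF assms(1)] by (auto simp: bij_betw_def)
  have "j \<noteq> 0"
  proof
    assume "j = 0"
    then show False
      using j assms(3) by simp
  qed
  define x where "x = real j * pi / real m"
  have l: "l = cis (2 * x)"
    by (simp add: j x_def field_simps)
  have "l + inverse l + 2 = complex_of_real (2 * cos (2 * x) + 2)"
    by (simp add: l complex_eq_iff)
  also have "2 * cos (2 * x) + 2 = (2 * cos x)\<^sup>2"
    by (simp add: cos_double_cos power_mult_distrib)
  finally have *: "l + inverse l + 2 = complex_of_real ((2 * cos x)\<^sup>2)" .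
  show thesis
  proof (cases "2 * j \<le> m")
    case True
    show thesis
      by (rule that[of j]) (use True \<open>j \<noteq> 0\<close> * in \<open>auto simp: two_cos_def x_def\<close>)
  next
    case False
    \<comment> \<open>If \<open>j\<close> exceeds half of \<open>m\<close>, it is replaced by
      \<open>m - j\<close>. This only changes the sign of the cosine, which the square does not
      see.\<close>
    have "real (m - j) * pi / real m = pi - x"
      using j assms(1) by (simp add: x_def of_nat_diff field_simps)
    then have "(two_cos m (m - j))\<^sup>2 = complex_of_real ((2 * cos x)\<^sup>2)"
      by (simp add: two_cos_def)
    with * show thesis
      using False j by (intro that[of "m - j"]) auto
  qed
qed

text \<open>The action of \<open>rt\<close> on the span of two basis vectors \<open>\<alpha>\<^sub>r, \<alpha>\<^sub>t\<close>, in coordinates, when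
  \<open>r \<alpha>\<^sub>t = \<alpha>\<^sub>t + c \<alpha>\<^sub>r\<close> and \<open>t \<alpha>\<^sub>r = \<alpha>\<^sub>r + d \<alpha>\<^sub>t\<close>. Its determinant is \<open>1\<close> and its trace \<open>c d - 2\<close>.\<close>

definition rot_matrix :: "complex \<Rightarrow> complex \<Rightarrow> complex \<times> complex \<Rightarrow> complex \<times> complex" where
  "rot_matrix c d = (\<lambda>(p, q). ((c * d - 1) * p - c * q, d * p - q))"

lemma rot_matrix_scale: "rot_matrix c d (l * p, l * q) = (l * fst (rot_matrix c d (p, q)), l * snd (rot_matrix c d (p, q)))"
  by (simp add: rot_matrix_def algebra_simps)

lemma funpow_rot_matrix_eigenvector:
  assumes "rot_matrix c d (p, q) = (l * p, l * q)"
  shows "(rot_matrix c d ^^ n) (p, q) = (l ^ n * p, l ^ n * q)"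
proof (induction n)
  case (Suc n)
  then show ?case
    using rot_matrix_scale[of c d "l ^ n" p q] assms by (simp add: mult_ac)
qed simp

text \<open>An eigenvalue \<open>l\<close> satisfies \<open>l ^ m = 1\<close>, and
  \<open>l = 1\<close> would give unbounded orbits, so \<open>root_of_unity_trace\<close> applies to
  the trace. In the case of a vanishing cosine finite order forces the matrix to be minus the
  identity.\<close>

lemma rot_matrix_finite_order_imp:
  assumes m: "0 < m" and fin: "\<And>z. (rot_matrix c d ^^ m) z = z"
  obtains k where "1 \<le> k" "2 * k \<le> m" "c * d = (two_cos m k)\<^sup>2" "two_cos m k = 0 \<Longrightarrow> c = 0 \<and> d = 0"
proof -
  define T where "T = c * d - 2"
  \<comment> \<open>\<open>l\<close> and \<open>u\<close> are the roots of the characteristic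
    polynomial \<open>X^2 - T * X + 1\<close>.\<close>
  define l where "l = (T + csqrt (T\<^sup>2 - 4)) / 2"
  define u where "u = T - l"
  have "2 * l - T = csqrt (T\<^sup>2 - 4)"
    by (simp add: l_def field_simps)
  then have "(2 * l - T)\<^sup>2 = T\<^sup>2 - 4"
    by simp
  moreover have "4 * (l * u) = T\<^sup>2 - (2 * l - T)\<^sup>2"
    by (simp add: u_def power2_eq_square algebra_simps)
  ultimately have lu: "l * u = 1"
    by simp
  have cd: "c * d = l + u + 2"
    by (simp add: u_def T_def)
  have "\<exists>p q. (p, q) \<noteq> (0, 0) \<and> rot_matrix c d (p, q) = (l * p, l * q)"
  proof (cases "c = 0 \<and> d = 0")
    case True
    then have u: "u = - l - 2"
      using cd by (simp add: algebra_simps eq_neg_iff_add_eq_0)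
    have "(l + 1)\<^sup>2 = 1 - l * u"
      unfolding u by (simp add: power2_eq_square algebra_simps)
    with lu have "(l + 1)\<^sup>2 = 0"
      by simp
    then have "l = -1"
      by (simp add: eq_neg_iff_add_eq_0)
    then show ?thesis
      using True by (intro exI[of _ 1]) (simp add: rot_matrix_def)
  next
    case False
    have "(c * d - 1) * (- c) - c * (- 1 - u) = l * (- c)"
      unfolding cd by (simp add: algebra_simps)
    moreover have "d * (- c) - (- 1 - u) = l * (- 1 - u)"
      using cd lu by (simp add: mult.commute[of d c] algebra_simps)
    ultimately have e1: "rot_matrix c d (- c, - 1 - u) = (l * (- c), l * (- 1 - u))"
      by (simp add: rot_matrix_def)
    have "(c * d - 1) * (l + 1) - c * d = l * (l + 1)"
      unfolding cd using lu by (simp add: algebra_simps)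
    moreover have "d * (l + 1) - d = l * d"
      by (simp add: algebra_simps)
    ultimately have e2: "rot_matrix c d (l + 1, d) = (l * (l + 1), l * d)"
      by (simp add: rot_matrix_def)
    \<comment> \<open>The two candidate eigenvectors complement each other:
      \<open>(- c, - 1 - u)\<close> is nonzero if \<open>c\<close> is, and \<open>(l + 1, d)\<close>
      is nonzero if \<open>d\<close> is.\<close>
    show ?thesis
    proof (cases "c = 0")
      case True
      then show ?thesis
        using False e2 by blast
    next
      case False
      then show ?thesis
        using e1 by (metis neg_equal_0_iff_equal prod.inject)
    qed
  qed
  then obtain p q where pq: "(p, q) \<noteq> (0, 0)" "rot_matrix c d (p, q) = (l * p, l * q)"
    by blast
  have lm: "l ^ m = 1"
    using funpow_rot_matrix_eigenvector[OF pq(2), of m] fin[of "(p, q)"] pq(1) by auto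
  have "l \<noteq> 1"
  proof
    assume "l = 1"
    then have cd4: "c * d = 4"
      using lu cd by simp
    \<comment> \<open>With both eigenvalues 1 the orbit grows linearly: the second coordinate
      returns to 1 only for \<open>n = 0\<close>.\<close>
    have "(rot_matrix c d ^^ n) (0, 1) = (- (of_nat n * c), 1 - 2 * of_nat n)" for n
    proof (induction n)
      case (Suc n)
      have "c * (c * d) = 4 * c"
        by (simp add: cd4)
      with Suc show ?case
        by (simp add: rot_matrix_def algebra_simps cd4)
    qed simp
    then show False
      using fin[of "(0, 1)"] m by simp
  qed
  moreover have "u = inverse l"
    using lu by (metis inverse_unique)
  ultimately obtain k where k: "1 \<le> k" "2 * k \<le> m" "c * d = (two_cos m k)\<^sup>2"
    using root_of_unity_trace[OF m lm] cd by metis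
  show thesis
  proof (rule that[OF k])
    assume "two_cos m k = 0"
    then have cd0: "c * d = 0"
      using k by simp
    \<comment> \<open>Now both eigenvalues are -1. The off-diagonal entries of the powers grow
      linearly in \<open>n\<close>, so periodicity at \<open>m > 0\<close> makes \<open>c\<close>
      and \<open>d\<close> vanish.\<close>
    have "(rot_matrix c d ^^ n) (0, 1) = ((-1) ^ n * (of_nat n * c), (-1) ^ n)"
      and "(rot_matrix c d ^^ n) (1, 0) = ((-1) ^ n, - ((-1) ^ n * (of_nat n * d)))" for n
    proof (induction n)
      case (Suc n)
      {
        case 1
        show ?case
          using Suc(1) cd0 by (auto simp: rot_matrix_def algebra_simps)
      next
        case 2
        show ?case
          using Suc(2) cd0 by (auto simp: rot_matrix_def algebra_simps)
      }
    qed simp_all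
    from this[of m] show "c = 0 \<and> d = 0"
      using fin[of "(0, 1)"] fin[of "(1, 0)"] m by simp
  qed
qed

text \<open>Factoring the recurrence, \<open>w (Suc n) - u * w n\<close> is geometric with ratio
  \<open>l\<close>, and symmetrically with the roots exchanged. Subtracting the two gives the
  formula, with \<open>l - u\<close> kept as a factor instead of being divided out.\<close>

lemma linear_recurrence_two_roots:
  fixes w :: "nat \<Rightarrow> complex"
  assumes "l * u = 1" "\<And>n. w (Suc (Suc n)) = (l + u) * w (Suc n) - w n"
  shows "(l - u) * w n = l ^ n * (w 1 - u * w 0) - u ^ n * (w 1 - l * w 0)"
proof -
  have A: "w (Suc n) - u * w n = l ^ n * (w 1 - u * w 0)" for n
  proof (induction n)
    case (Suc n)
    have "w (Suc (Suc n)) - u * w (Suc n) = l * w (Suc n) - (l * u) * w n"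
      by (simp add: assms algebra_simps)
    also have "\<dots> = l * (w (Suc n) - u * w n)"
      by (simp add: algebra_simps)
    finally show ?case
      using Suc by simp
  qed simp
  have B: "w (Suc n) - l * w n = u ^ n * (w 1 - l * w 0)" for n
  proof (induction n)
    case (Suc n)
    have "w (Suc (Suc n)) - l * w (Suc n) = u * w (Suc n) - (l * u) * w n"
      by (simp add: assms algebra_simps)
    also have "\<dots> = u * (w (Suc n) - l * w n)"
      by (simp add: algebra_simps)
    finally show ?case
      using Suc by simp
  qed simp
  have "(l - u) * w n = (w (Suc n) - u * w n) - (w (Suc n) - l * w n)"
    by (simp add: algebra_simps)
  then show ?thesis
    unfolding A B .
qed

text \<open>Converse of \<open>rot_matrix_finite_order_imp\<close>. If the cosine vanishes, the
  matrix is minus the identity and \<open>m\<close> is even. Otherwise the eigenvalues are distinct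
  \<open>m\<close>-th roots of unity, so every orbit has period \<open>m\<close>.\<close>

lemma rot_matrix_finite_order:
  assumes k: "1 \<le> k" "2 * k \<le> m" and cd: "c * d = (two_cos m k)\<^sup>2" "two_cos m k = 0 \<Longrightarrow> c = 0 \<and> d = 0"
  shows "(rot_matrix c d ^^ m) z = z"
proof (cases "two_cos m k = 0")
  case True
  then have "c = 0" "d = 0" "m = 2 * k"
    using cd two_cos_eq_0_iff[OF k] by auto
  moreover have "(rot_matrix 0 0 ^^ n) z = ((-1) ^ n * fst z, (-1) ^ n * snd z)" for n
    by (induction n) (auto simp: rot_matrix_def)
  ultimately show ?thesis
    by simp
next
  case False
  define x where "x = real k * pi / real m"
  define l where "l = cis (2 * x)"
  define u where "u = cis (- (2 * x))"
  have lu: "l * u = 1"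
    by (simp add: l_def u_def cis_mult)
  have "m > 0"
    using k by simp
  then have mx: "real m * (2 * x) = 2 * pi * real k"
    by (simp add: x_def)
  then have lm: "l ^ m = 1"
    unfolding l_def DeMoivre mx by (intro cis_multiple_2pi) simp
  have um: "u ^ m = 1"
    using lu lm by (metis mult.left_neutral power_mult_distrib power_one)
  have "l + u + 2 = complex_of_real (2 * cos (2 * x) + 2)"
    by (simp add: l_def u_def complex_eq_iff)
  also have "2 * cos (2 * x) + 2 = (2 * cos x)\<^sup>2"
    by (simp add: cos_double_cos power_mult_distrib)
  finally have T: "c * d = l + u + 2"
    by (simp add: cd two_cos_def x_def)
  \<comment> \<open>Equality and \<open>l * u = 1\<close> would give \<open>l = 1\<close> or
    \<open>l = -1\<close>, that is \<open>c * d = 4\<close> or \<open>c * d = 0\<close>; both are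
    excluded.\<close>
  have "l \<noteq> u"
  proof
    assume "l = u"
    then have "l\<^sup>2 = 1"
      using lu by (simp add: power2_eq_square)
    then have "l = 1 \<or> l = -1"
      by (simp add: power2_eq_1_iff)
    then show False
      using \<open>l = u\<close> T False two_cos_power2_neq_4[OF k] cd(1) by auto
  qed
  define w where "w n = (rot_matrix c d ^^ n) z" for n
  \<comment> \<open>Cayley-Hamilton for a matrix of determinant 1 and trace \<open>l + u\<close>,
    read off coordinatewise.\<close>
  have rec: "fst (w (Suc (Suc n))) = (l + u) * fst (w (Suc n)) - fst (w n)"
    "snd (w (Suc (Suc n))) = (l + u) * snd (w (Suc n)) - snd (w n)" for n
  proof -
    obtain p q where "w n = (p, q)"
      by fastforce
    then have w: "w (Suc n) = rot_matrix c d (p, q)" "w (Suc (Suc n)) = rot_matrix c d (rot_matrix c d (p, q))" "w n = (p, q)"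
      by (simp_all add: w_def)
    have lu': "l + u = c * d - 2"
      using T by simp
    show "fst (w (Suc (Suc n))) = (l + u) * fst (w (Suc n)) - fst (w n)"
      "snd (w (Suc (Suc n))) = (l + u) * snd (w (Suc n)) - snd (w n)"
      unfolding w lu' by (simp_all add: rot_matrix_def algebra_simps)
  qed
  have "(l - u) * fst (w m) = (l - u) * fst (w 0)" "(l - u) * snd (w m) = (l - u) * snd (w 0)"
    using linear_recurrence_two_roots[of l u "\<lambda>n. fst (w n)" m, OF lu rec(1)]
      linear_recurrence_two_roots[of l u "\<lambda>n. snd (w n)" m, OF lu rec(2)] lm um
    by (simp_all add: algebra_simps)
  then have "w m = w 0"
    using \<open>l \<noteq> u\<close> by (simp add: prod_eq_iff)
  then show ?thesis
    by (simp add: w_def)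
qed

section \<open>The matrix of an IR-representation\<close>

context complex_vector_space begin

lemma linear_map_onD:
  assumes "linear_map_on V V' f"
  shows linear_map_on_closed: "\<And>x. x \<in> V \<Longrightarrow> f x \<in> V'"
    and linear_map_on_add: "\<And>x y. x \<in> V \<Longrightarrow> y \<in> V \<Longrightarrow> f (x + y) = f x + f y"
    and linear_map_on_scale: "\<And>c x. x \<in> V \<Longrightarrow> f (scale c x) = scale c (f x)"
  using assms by (auto simp: linear_map_on_def)

lemma linear_map_on_zero: "linear_map_on V V' f \<Longrightarrow> subspace V \<Longrightarrow> f 0 = 0"
  using linear_map_on_scale[of V V' f 0 0] subspace_0 by auto

lemma linear_map_on_compose:
  "linear_map_on V V' f \<Longrightarrow> linear_map_on V' V'' g \<Longrightarrow> linear_map_on V V'' (\<lambda>x. g (f x))"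
  by (auto simp: linear_map_on_def Pi_iff)

lemma linear_map_on_eq_on_span:
  assumes f: "linear_map_on (span B) V f" and g: "linear_map_on (span B) V' g"
    and "\<And>b. b \<in> B \<Longrightarrow> f b = g b" and "x \<in> span B"
  shows "f x = g x"
proof -
  have "x \<in> span B \<and> f x = g x"
    using assms(4)
  proof (induction rule: span_induct_alt)
    case base
    then show ?case
      using linear_map_on_zero[OF f] linear_map_on_zero[OF g] by (simp add: span_zero)
  next
    case (step c x y)
    then have "x \<in> span B" "scale c x \<in> span B"
      by (auto intro: span_base span_scale)
    then show ?case
      using step assms(3) linear_map_onD[OF f] linear_map_onD[OF g] by (simp add: span_add)
  qed
  then show ?thesis ..
qed

lemma linear_imp_linear_map_on:
  assumes "Vector_Spaces.linear scale scale g" "\<And>b. b \<in> B \<Longrightarrow> g b \<in> V'" "subspace V'"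
  shows "linear_map_on (span B) V' g"
proof -
  interpret g: Vector_Spaces.linear scale scale g
    by (rule assms(1))
  have "g x \<in> V'" if "x \<in> span B" for x
    using that
  proof (induction rule: span_induct_alt)
    case base
    then show ?case
      using assms(3) by (simp add: g.zero subspace_0)
  next
    case (step c x y)
    then show ?case
      using assms(2,3) by (simp add: g.add g.scale subspace_add subspace_scale)
  qed
  then show ?thesis
    by (auto simp: linear_map_on_def g.add g.scale)
qed

lemma linear_extension:
  assumes "independent B"
  obtains g where "Vector_Spaces.linear scale scale g" "\<And>b. b \<in> B \<Longrightarrow> g b = h b"
proof -
  interpret vector_space_pair scale scale ..
  show thesis
    using linear_independent_extend[OF assms, of h] that by blast
qed

lemma independent_pair:
  assumes "independent B" "a \<in> B" "b \<in> B" "a \<noteq> b" "scale p a + scale q b = 0"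
  shows "p = 0 \<and> q = 0"
proof -
  let ?u = "\<lambda>v. if v = a then p else q"
  have "(\<Sum>v\<in>{a, b}. scale (?u v) v) = 0"
    using assms(4,5) by simp
  then have "?u v = 0" if "v \<in> {a, b}" for v
    using independentD[OF assms(1), of "{a, b}" ?u v] assms(2,3) that by blast
  from this[of a] this[of b] show ?thesis
    using assms(4) by simp
qed

text \<open>The matrix \<open>c\<close> plays the role of the coefficients \<open>2 (a\<^sub>r\<^sup>t / a\<^sub>t\<^sup>r) cos (k\<^sub>r\<^sub>t \<pi> / m\<^sub>r\<^sub>t)\<close>; it describes an
  IR-representation without reference to the choice of the numbers \<open>a\<^sub>r\<^sup>t\<close>.\<close>

definition refl_matrix ::
  "'s set \<Rightarrow> 'v set \<Rightarrow> ('s \<Rightarrow> 'v \<Rightarrow> 'v) \<Rightarrow> ('s \<Rightarrow> 'v) \<Rightarrow> ('s \<Rightarrow> 's \<Rightarrow> complex) \<Rightarrow> bool" where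
  "refl_matrix S V \<rho> \<alpha> c \<longleftrightarrow>
     inj_on \<alpha> S \<and> independent (\<alpha> ` S) \<and> span (\<alpha> ` S) = V \<and>
     (\<forall>s\<in>S. c s s = -2 \<and> (\<forall>t\<in>S. \<rho> s (\<alpha> t) = \<alpha> t + scale (c s t) (\<alpha> s)))"

lemma refl_matrixD:
  assumes "refl_matrix S V \<rho> \<alpha> c"
  shows "inj_on \<alpha> S" "independent (\<alpha> ` S)" "span (\<alpha> ` S) = V" "subspace V"
    "\<And>s. s \<in> S \<Longrightarrow> c s s = -2" "\<And>s. s \<in> S \<Longrightarrow> \<alpha> s \<in> V" "\<And>s. s \<in> S \<Longrightarrow> \<alpha> s \<noteq> 0"
    "\<And>s t. s \<in> S \<Longrightarrow> t \<in> S \<Longrightarrow> \<rho> s (\<alpha> t) = \<alpha> t + scale (c s t) (\<alpha> s)"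
  using assms dependent_zero[of "\<alpha> ` S"] by (auto simp: refl_matrix_def intro: span_base)

lemma add_scale_minus_two: "a + scale (-2) a = - a"
proof -
  have "a + scale (-2) a = scale 1 a + scale (-2) a"
    by simp
  also have "\<dots> = scale (-1) a"
    unfolding scale_left_distrib[symmetric] by simp
  finally show ?thesis
    by (simp add: scale_minus_left)
qed

lemma minus_eq_self_iff: "- a = a \<longleftrightarrow> (a :: 'v) = 0"
proof
  assume "- a = a"
  then have "a + a = 0"
    by (metis add.right_inverse)
  moreover have "scale 2 a = a + a"
    using scale_left_distrib[of 1 1 a] by simp
  ultimately show "a = 0"
    by simp
qed simp

text \<open>All displacements by \<open>s\<close> lie on the line of \<open>\<alpha> s\<close>. In
  particular any eigenvector for -1 lies on it, which later fixes the basis up to scalars.\<close>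

lemma reflection_displacement:
  assumes "refl_matrix S V \<rho> \<alpha> c" "linear_map_on V V (\<rho> s)" "s \<in> S" "x \<in> V"
  shows "\<exists>k. \<rho> s x = x + scale k (\<alpha> s)"
proof -
  note R = refl_matrixD[OF assms(1)]
  have "x \<in> span (\<alpha> ` S)"
    using assms(4) R(3) by simp
  then have "x \<in> V \<and> (\<exists>k. \<rho> s x = x + scale k (\<alpha> s))"
  proof (induction rule: span_induct_alt)
    case base
    then show ?case
      using R(4) linear_map_on_zero[OF assms(2)] by (auto intro!: exI[of _ 0] subspace_0)
  next
    case (step l y z)
    then obtain t k where t: "t \<in> S" "y = \<alpha> t" and z: "z \<in> V" "\<rho> s z = z + scale k (\<alpha> s)"
      by blast
    have y: "y \<in> V" "\<rho> s y = y + scale (c s t) (\<alpha> s)"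
      using t R assms(3) by auto
    have V: "scale l y \<in> V" "scale l y + z \<in> V"
      using y z R(4) by (auto intro: subspace_add subspace_scale)
    have "\<rho> s (scale l y + z) = (scale l y + z) + scale (l * c s t + k) (\<alpha> s)"
      using y z V linear_map_onD[OF assms(2)]
      by (simp add: scale_right_distrib scale_left_distrib add_ac)
    then show ?case
      using V(2) by blast
  qed
  then show ?thesis ..
qed

text \<open>The vector \<open>\<alpha> s\<close> is negated and so lies outside the fixed hyperplane
  \<open>H\<close>; hence \<open>V\<close> is spanned by both. Writing
  \<open>\<alpha> t = h + k \<alpha> s\<close> with \<open>h\<close> in \<open>H\<close> gives the
  coefficient \<open>- 2 * k\<close>.\<close>

lemma IR_basis_imp_refl_matrix:
  assumes fin: "finite S" and V: "subspace V" and lin: "\<And>s. s \<in> S \<Longrightarrow> linear_map_on V V (\<rho> s)"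
    and IR: "IR_basis S V \<rho> \<alpha>"
  shows "\<exists>c. refl_matrix S V \<rho> \<alpha> c"
proof -
  have inj: "inj_on \<alpha> S" and ind: "independent (\<alpha> ` S)" and span: "span (\<alpha> ` S) = V"
    using IR by (auto simp: IR_basis_def)
  have \<alpha>V: "\<alpha> t \<in> V" if "t \<in> S" for t
    using that span span_base by blast
  have \<alpha>0: "\<alpha> t \<noteq> 0" if "t \<in> S" for t
    using that ind dependent_zero[of "\<alpha> ` S"] by (metis imageI)
  have ex: "\<exists>k. \<rho> s (\<alpha> t) = \<alpha> t + scale k (\<alpha> s)" if s: "s \<in> S" and t: "t \<in> S" for s t
  proof -
    obtain H where H: "subspace H" "H \<subseteq> V" "dim H + 1 = dim V" "\<And>x. x \<in> H \<Longrightarrow> \<rho> s x = x"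
      and neg: "\<rho> s (\<alpha> s) = - \<alpha> s"
      using IR s by (auto simp: IR_basis_def)
    obtain B where B: "B \<subseteq> H" "independent B" "H \<subseteq> span B" "card B = dim H"
      by (rule basis_exists)
    have spanB: "span B = H"
      using B H(1) span_subspace by blast
    have finB: "finite B"
      using independent_span_bound[of "\<alpha> ` S" B] fin B H(2) span by blast
    have notin: "\<alpha> s \<notin> H"
      using H(4)[of "\<alpha> s"] neg minus_eq_self_iff[of "\<alpha> s"] \<alpha>0[OF s] by auto
    then have ind': "independent (insert (\<alpha> s) B)"
      using B(2) spanB by (intro independent_insertI) auto
    have card': "card (insert (\<alpha> s) B) = card (\<alpha> ` S)"
    proof -
      have "\<alpha> s \<notin> B"
        using notin B(1) by blast
      then show ?thesis
        using finB B H(3) dim_span_eq_card_independent[OF ind] span by simp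
    qed
    \<comment> \<open>Dimension count: \<open>\<alpha> s\<close> and a basis of \<open>H\<close>
      already have as many elements as \<open>S\<close>, so no further independent vector of
      \<open>V\<close> fits.\<close>
    have "\<alpha> t \<in> span (insert (\<alpha> s) B)"
    proof (rule ccontr)
      assume n: "\<alpha> t \<notin> span (insert (\<alpha> s) B)"
      then have "independent (insert (\<alpha> t) (insert (\<alpha> s) B))"
        using ind' by (rule independent_insertI)
      moreover have "insert (\<alpha> t) (insert (\<alpha> s) B) \<subseteq> span (\<alpha> ` S)"
        using \<alpha>V s t B(1) H(2) span by auto
      ultimately have "card (insert (\<alpha> t) (insert (\<alpha> s) B)) \<le> card (\<alpha> ` S)"
        using independent_span_bound[of "\<alpha> ` S"] fin by blast
      moreover have "\<alpha> t \<notin> insert (\<alpha> s) B"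
        using n span_base by blast
      ultimately show False
        using card' finB by simp
    qed
    then obtain k where k: "\<alpha> t - scale k (\<alpha> s) \<in> H"
      using spanB span_breakdown_eq by blast
    define h where "h = \<alpha> t - scale k (\<alpha> s)"
    have at: "\<alpha> t = h + scale k (\<alpha> s)"
      by (simp add: h_def)
    have "h \<in> V" "\<rho> s h = h"
      using k H by (auto simp: h_def)
    then have "\<rho> s (\<alpha> t) = h + scale k (- \<alpha> s)"
      unfolding at using linear_map_onD[OF lin[OF s]] \<alpha>V[OF s] neg V by (simp add: subspace_scale)
    also have "\<dots> = \<alpha> t + scale (- (2 * k)) (\<alpha> s)"
    proof -
      have e: "scale k (\<alpha> s) + scale (- (2 * k)) (\<alpha> s) = scale (- k) (\<alpha> s)"
        unfolding scale_left_distrib[symmetric] by simp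
      show ?thesis
        by (simp only: at add.assoc e) (simp only: scale_minus_left scale_minus_right)
    qed
    finally show ?thesis ..
  qed
  define c where "c s t = (if s = t then -2 else SOME k. \<rho> s (\<alpha> t) = \<alpha> t + scale k (\<alpha> s))" for s t
  have "\<rho> s (\<alpha> t) = \<alpha> t + scale (c s t) (\<alpha> s)" if "s \<in> S" "t \<in> S" for s t
  proof (cases "s = t")
    case True
    have "\<rho> s (\<alpha> s) = - \<alpha> s"
      using IR that by (auto simp: IR_basis_def)
    moreover have "c s t = -2"
      using True by (simp add: c_def)
    ultimately show ?thesis
      using True add_scale_minus_two by metis
  next
    case False
    then show ?thesis
      using someI_ex[OF ex[OF that]] by (simp add: c_def)
  qed
  then have "refl_matrix S V \<rho> \<alpha> c"
    using inj ind span by (simp add: refl_matrix_def) (simp add: c_def)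
  then show ?thesis
    by blast
qed

text \<open>The hyperplane is the full fixed space of \<open>s\<close>. It has codimension 1 because
  every \<open>\<alpha> t\<close> is a fixed vector plus a multiple of
  \<open>\<alpha> s\<close>.\<close>

lemma refl_matrix_imp_IR_basis:
  assumes fin: "finite S" and lin: "\<And>s. s \<in> S \<Longrightarrow> linear_map_on V V (\<rho> s)"
    and R: "refl_matrix S V \<rho> \<alpha> c"
  shows "IR_basis S V \<rho> \<alpha>"
proof -
  note D = refl_matrixD[OF R]
  have neg: "\<rho> s (\<alpha> s) = - \<alpha> s" if "s \<in> S" for s
    unfolding D(8)[OF that that] D(5)[OF that] by (rule add_scale_minus_two)
  have "\<exists>H. subspace H \<and> H \<subseteq> V \<and> dim H + 1 = dim V \<and> (\<forall>x\<in>H. \<rho> s x = x)" if s: "s \<in> S" for s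
  proof -
    note L = linear_map_onD[OF lin[OF s]]
    define H where "H = {x \<in> V. \<rho> s x = x}"
    have subH: "subspace H"
      using D(4) L linear_map_on_zero[OF lin[OF s]]
      by (auto simp: H_def subspace_def)
    obtain B where B: "B \<subseteq> H" "independent B" "H \<subseteq> span B" "card B = dim H"
      by (rule basis_exists)
    have spanB: "span B = H"
      using B subH span_subspace by blast
    have finB: "finite B"
      using independent_span_bound[of "\<alpha> ` S" B] fin B D(3) by (auto simp: H_def)
    have notin: "\<alpha> s \<notin> H"
      using neg[OF s] minus_eq_self_iff[of "\<alpha> s"] D(7)[OF s] by (auto simp: H_def)
    then have ind': "independent (insert (\<alpha> s) B)"
      using B(2) spanB by (intro independent_insertI) auto
    have "\<alpha> t \<in> span (insert (\<alpha> s) B)" if t: "t \<in> S" for t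
    proof -
      \<comment> \<open>The projection of \<open>\<alpha> t\<close> to the fixed space: the midpoint
        of \<open>\<alpha> t\<close> and its image under \<open>s\<close>.\<close>
      let ?h = "\<alpha> t + scale (c s t / 2) (\<alpha> s)"
      have "\<rho> s ?h = \<alpha> t + (scale (c s t) (\<alpha> s) + scale (c s t / 2) (- \<alpha> s))"
        using s t D neg[OF s] L by (simp add: subspace_scale)
      also have "scale (c s t) (\<alpha> s) + scale (c s t / 2) (- \<alpha> s) = scale (c s t / 2) (\<alpha> s)"
        unfolding scale_minus_right[of "c s t / 2"] scale_minus_left[symmetric] scale_left_distrib[symmetric]
        by simp
      finally have "?h \<in> H"
        using s t D by (simp add: H_def subspace_add subspace_scale)
      then have "?h - scale (c s t / 2) (\<alpha> s) \<in> span (insert (\<alpha> s) B)"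
        using spanB span_mono[of B "insert (\<alpha> s) B"]
        by (intro span_diff) (auto intro: span_scale span_base)
      then show ?thesis
        by simp
    qed
    then have "V \<subseteq> span (insert (\<alpha> s) B)"
      unfolding D(3)[symmetric] by (intro span_minimal) auto
    moreover have "insert (\<alpha> s) B \<subseteq> V"
      using D(6)[OF s] B(1) by (auto simp: H_def)
    ultimately have "dim V = card (insert (\<alpha> s) B)"
      using basis_card_eq_dim[OF _ _ ind'] by simp
    also have "\<dots> = dim H + 1"
      using finB notin B by (auto simp: card_insert_if)
    finally show ?thesis
      using subH by (intro exI[of _ H]) (auto simp: H_def)
  qed
  then show ?thesis
    using D neg by (auto simp: IR_basis_def)
qed

text \<open>Reduces \<open>dihedral_iso\<close> to scalar equations. Bijectivity amounts to
  \<open>p\<close> and \<open>q\<close> being nonzero, and comparing coordinates in the basis of the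
  plane turns equivariance under \<open>r\<close> and under \<open>t\<close> into one equation
  each.\<close>

lemma dihedral_iso_iff:
  assumes R: "refl_matrix S V \<rho> \<alpha> c" and rt: "r \<in> S" "t \<in> S" "r \<noteq> t"
    and lin: "linear_map_on V V (\<rho> r)" "linear_map_on V V (\<rho> t)"
  shows "dihedral_iso \<rho> \<alpha> r t m k p q \<longleftrightarrow>
    p \<noteq> 0 \<and> q \<noteq> 0 \<and> c r t * q = two_cos m k * p \<and> c t r * p = two_cos m k * q"
proof -
  note D = refl_matrixD[OF R]
  define \<phi> where "\<phi> = (\<lambda>(x, y). scale (x * p) (\<alpha> r) + scale (y * q) (\<alpha> t))"
  have eq_iff: "scale x (\<alpha> r) + scale y (\<alpha> t) = scale x' (\<alpha> r) + scale y' (\<alpha> t) \<longleftrightarrow> x = x' \<and> y = y'"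
    for x y x' y'
  proof
    assume "scale x (\<alpha> r) + scale y (\<alpha> t) = scale x' (\<alpha> r) + scale y' (\<alpha> t)"
    then have "scale (x - x') (\<alpha> r) + scale (y - y') (\<alpha> t) = 0"
      by (simp add: scale_left_diff_distrib algebra_simps)
    then have "x - x' = 0 \<and> y - y' = 0"
      by (rule independent_pair[OF D(2), rotated -1]) (use rt D(1) in \<open>auto dest: inj_onD\<close>)
    then show "x = x' \<and> y = y'"
      by simp
  qed simp
  have refl: "\<rho> r (scale x (\<alpha> r) + scale y (\<alpha> t)) = scale (- x + c r t * y) (\<alpha> r) + scale y (\<alpha> t)"
    "\<rho> t (scale x (\<alpha> r) + scale y (\<alpha> t)) = scale x (\<alpha> r) + scale (- y + c t r * x) (\<alpha> t)" for x y
  proof -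
    have neg: "\<rho> r (\<alpha> r) = - \<alpha> r" "\<rho> t (\<alpha> t) = - \<alpha> t"
      using D(5,8) rt add_scale_minus_two by metis+
    have "scale x (\<alpha> r) \<in> V" "scale y (\<alpha> t) \<in> V" "\<alpha> r \<in> V" "\<alpha> t \<in> V"
      using D(4,6) rt by (simp_all add: subspace_scale)
    then show "\<rho> r (scale x (\<alpha> r) + scale y (\<alpha> t)) = scale (- x + c r t * y) (\<alpha> r) + scale y (\<alpha> t)"
      "\<rho> t (scale x (\<alpha> r) + scale y (\<alpha> t)) = scale x (\<alpha> r) + scale (- y + c t r * x) (\<alpha> t)"
      using linear_map_onD[OF lin(1)] linear_map_onD[OF lin(2)] D(8)[of r t] D(8)[of t r] rt
      by (simp_all add: neg scale_right_distrib scale_left_distrib scale_left_diff_distrib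
          scale_minus_left scale_minus_right mult.commute)
  qed
  have equi: "\<phi> (rho_r m k (x, y)) = \<rho> r (\<phi> (x, y)) \<longleftrightarrow> (two_cos m k * y) * p = c r t * (y * q)"
    "\<phi> (rho_t m k (x, y)) = \<rho> t (\<phi> (x, y)) \<longleftrightarrow> (two_cos m k * x) * q = c t r * (x * p)" for x y
  proof -
    have "\<phi> (rho_r m k (x, y)) = scale ((- x + two_cos m k * y) * p) (\<alpha> r) + scale (y * q) (\<alpha> t)"
      "\<phi> (rho_t m k (x, y)) = scale (x * p) (\<alpha> r) + scale ((- y + two_cos m k * x) * q) (\<alpha> t)"
      "\<phi> (x, y) = scale (x * p) (\<alpha> r) + scale (y * q) (\<alpha> t)"
      by (simp_all add: \<phi>_def rho_r_def rho_t_def two_cos_def)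
    then show "\<phi> (rho_r m k (x, y)) = \<rho> r (\<phi> (x, y)) \<longleftrightarrow> (two_cos m k * y) * p = c r t * (y * q)"
      "\<phi> (rho_t m k (x, y)) = \<rho> t (\<phi> (x, y)) \<longleftrightarrow> (two_cos m k * x) * q = c t r * (x * p)"
      by (simp_all only: refl eq_iff) (simp_all add: algebra_simps)
  qed
  have "bij_betw \<phi> UNIV (span {\<alpha> r, \<alpha> t}) \<longleftrightarrow> p \<noteq> 0 \<and> q \<noteq> 0"
  proof
    assume "bij_betw \<phi> UNIV (span {\<alpha> r, \<alpha> t})"
    then have "inj \<phi>"
      by (simp add: bij_betw_def)
    then have "\<phi> (1, 0) \<noteq> \<phi> (0, 0)" "\<phi> (0, 1) \<noteq> \<phi> (0, 0)"
      by (simp_all add: inj_eq)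
    then show "p \<noteq> 0 \<and> q \<noteq> 0"
      by (auto simp: \<phi>_def)
  next
    assume pq: "p \<noteq> 0 \<and> q \<noteq> 0"
    have "inj \<phi>"
      using pq by (auto simp: inj_def \<phi>_def eq_iff)
    moreover have "range \<phi> = span {\<alpha> r, \<alpha> t}"
    proof
      show "range \<phi> \<subseteq> span {\<alpha> r, \<alpha> t}"
        by (auto simp: \<phi>_def intro!: span_add span_scale intro: span_base)
      show "span {\<alpha> r, \<alpha> t} \<subseteq> range \<phi>"
      proof
        fix v assume "v \<in> span {\<alpha> r, \<alpha> t}"
        then obtain x y where "v - scale x (\<alpha> r) = scale y (\<alpha> t)"
          by (auto simp: span_insert[of "\<alpha> r"] span_singleton)
        then have "v = \<phi> (x / p, y / q)"
          using pq by (simp add: \<phi>_def algebra_simps)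
        then show "v \<in> range \<phi>"
          by blast
      qed
    qed
    ultimately show "bij_betw \<phi> UNIV (span {\<alpha> r, \<alpha> t})"
      by (simp add: bij_betw_def)
  qed
  moreover have "(\<forall>z. \<phi> (rho_r m k z) = \<rho> r (\<phi> z)) \<longleftrightarrow> c r t * q = two_cos m k * p"
  proof -
    have "(\<forall>z. \<phi> (rho_r m k z) = \<rho> r (\<phi> z)) \<longleftrightarrow> (\<forall>y. y * (two_cos m k * p) = y * (c r t * q))"
      by (simp only: split_paired_All equi) (simp add: mult_ac)
    also have "\<dots> \<longleftrightarrow> c r t * q = two_cos m k * p"
      by (metis mult.left_neutral)
    finally show ?thesis .
  qed
  moreover have "(\<forall>z. \<phi> (rho_t m k z) = \<rho> t (\<phi> z)) \<longleftrightarrow> c t r * p = two_cos m k * q"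
  proof -
    have "(\<forall>z. \<phi> (rho_t m k z) = \<rho> t (\<phi> z)) \<longleftrightarrow> (\<forall>x. x * (two_cos m k * q) = x * (c t r * p))"
      by (simp only: split_paired_All equi) (simp add: mult_ac)
    also have "\<dots> \<longleftrightarrow> c t r * p = two_cos m k * q"
      by (metis mult.left_neutral)
    finally show ?thesis .
  qed
  ultimately show ?thesis
    unfolding dihedral_iso_def Let_def \<phi>_def[symmetric] by blast
qed

end

section \<open>Words in a Coxeter group and the dihedral relations\<close>

locale coxeter_IR = complex_vector_space scale
  for scale :: "complex \<Rightarrow> 'v::ab_group_add \<Rightarrow> 'v" +
  fixes W :: "('g, 'b) monoid_scheme" and S :: "'g set" and m :: "'g \<Rightarrow> 'g \<Rightarrow> nat"
  assumes coxeter: "coxeter_system W S m"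
    and finite_S: "finite S"
    and m_nonzero: "\<And>r t. r \<in> S \<Longrightarrow> t \<in> S \<Longrightarrow> m r t \<noteq> 0"
begin

lemma group_W: "group W"
  and S_subset: "S \<subseteq> carrier W"
  and generate_S: "generate W S = carrier W"
  and word_value_eq_iff: "\<And>u v. \<lbrakk>u \<in> lists (S \<times> UNIV); v \<in> lists (S \<times> UNIV)\<rbrakk> \<Longrightarrow>
      word_value W u = word_value W v \<longleftrightarrow> word_equiv S (coxeter_relators S m) u v"
  and m_commute: "\<And>r t. \<lbrakk>r \<in> S; t \<in> S\<rbrakk> \<Longrightarrow> m r t = m t r"
  using coxeter unfolding coxeter_system_def presented_by_def coxeter_matrix_def by auto

interpretation W: group W
  by (rule group_W)

lemma S_in_carrier [simp]: "s \<in> S \<Longrightarrow> s \<in> carrier W"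
  using S_subset by auto

lemma word_value_Nil [simp]: "word_value W [] = \<one>\<^bsub>W\<^esub>"
  and word_value_Cons [simp]: "word_value W ((s, b) # u) = (if b then inv\<^bsub>W\<^esub> s else s) \<otimes>\<^bsub>W\<^esub> word_value W u"
  by (simp_all add: word_value_def)

lemma word_value_closed [simp]: "u \<in> lists (S \<times> UNIV) \<Longrightarrow> word_value W u \<in> carrier W"
  by (induction u) auto

lemma word_value_append:
  "u \<in> lists (S \<times> UNIV) \<Longrightarrow> v \<in> lists (S \<times> UNIV) \<Longrightarrow>
     word_value W (u @ v) = word_value W u \<otimes>\<^bsub>W\<^esub> word_value W v"
proof (induction u)
  case (Cons a u)
  then have "u \<in> lists (S \<times> UNIV)" "fst a \<in> S"
    by auto
  then show ?case
    using Cons word_value_closed[of u] word_value_closed[of v]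
    by (cases a) (simp add: W.m_assoc del: in_lists_conv_set)
qed simp

lemma ex_word_value:
  assumes "w \<in> carrier W"
  shows "\<exists>u \<in> lists (S \<times> UNIV). word_value W u = w"
proof -
  have "w \<in> generate W S"
    using assms generate_S by simp
  then show ?thesis
  proof (induction rule: generate.induct)
    case one
    then show ?case
      by (intro bexI[of _ "[]"]) auto
  next
    case (incl h)
    then show ?case
      by (intro bexI[of _ "[(h, False)]"]) auto
  next
    case (inv h)
    then show ?case
      by (intro bexI[of _ "[(h, True)]"]) auto
  next
    case (eng h1 h2)
    then show ?case
      by (metis word_value_append append_in_lists_conv)
  qed
qed

abbreviation pair_word :: "'g \<Rightarrow> 'g \<Rightarrow> nat \<Rightarrow> 'g word" where
  "pair_word r t n \<equiv> concat (replicate n [(r, False), (t, False)])"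

lemma pair_word_in_lists: "r \<in> S \<Longrightarrow> t \<in> S \<Longrightarrow> pair_word r t n \<in> lists (S \<times> UNIV)"
  by (induction n) auto

lemma word_value_braid:
  assumes "r \<in> S" "t \<in> S" "r \<noteq> t"
  shows "word_value W (pair_word r t (m r t)) = \<one>\<^bsub>W\<^esub>"
proof -
  have "pair_word r t (m r t) \<in> coxeter_relators S m"
    using assms by (auto simp: coxeter_relators_def)
  then have "word_equiv S (coxeter_relators S m) (pair_word r t (m r t)) []"
    by (rule word_equiv.relator)
  then have "word_value W (pair_word r t (m r t)) = word_value W []"
    using word_value_eq_iff[of "pair_word r t (m r t)" "[]"] pair_word_in_lists[OF assms(1,2)] by simp
  then show ?thesis
    by simp
qed

lemma group_representationD:
  assumes "group_representation W V \<rho>"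
  shows "subspace V" "\<And>w. w \<in> carrier W \<Longrightarrow> linear_map_on V V (\<rho> w)"
    "\<And>x. x \<in> V \<Longrightarrow> \<rho> \<one>\<^bsub>W\<^esub> x = x"
    "\<And>u w x. \<lbrakk>u \<in> carrier W; w \<in> carrier W; x \<in> V\<rbrakk> \<Longrightarrow> \<rho> (u \<otimes>\<^bsub>W\<^esub> w) x = \<rho> u (\<rho> w x)"
  using assms by (auto simp: group_representation_def)

lemma rep_pair_power:
  assumes G: "group_representation W V \<rho>" and rt: "r \<in> S" "t \<in> S" "r \<noteq> t" and x: "x \<in> V"
  shows "((\<lambda>y. \<rho> r (\<rho> t y)) ^^ m r t) x = x"
proof -
  note D = group_representationD[OF G]
  have "\<rho> (word_value W (pair_word r t n)) x = ((\<lambda>y. \<rho> r (\<rho> t y)) ^^ n) x" for n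
  proof (induction n)
    case 0
    then show ?case
      using D(3) x by simp
  next
    case (Suc n)
    have c: "word_value W (pair_word r t n) \<in> carrier W"
      by (rule word_value_closed[OF pair_word_in_lists[OF rt(1,2)]])
    have "\<rho> (word_value W (pair_word r t n)) x \<in> V"
      using linear_map_on_closed[OF D(2)[OF c] x] .
    then show ?case
      using rt c x Suc D(4) by simp
  qed
  from this[of "m r t"] show ?thesis
    using word_value_braid[OF rt] D(3)[OF x] by simp
qed

text \<open>Identifies \<open>rt\<close> on the plane of \<open>\<alpha> r\<close> and
  \<open>\<alpha> t\<close> with \<open>rot_matrix\<close>. Only the linearity of the two maps is
  assumed, so the lemma serves both given representations and the construction of new ones.\<close>

lemma pair_power_eq_rot:
  assumes R: "refl_matrix S V \<rho> \<alpha> c" and rt: "r \<in> S" "t \<in> S" "r \<noteq> t"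
    and lin: "linear_map_on V V (\<rho> r)" "linear_map_on V V (\<rho> t)"
  shows "((\<lambda>y. \<rho> r (\<rho> t y)) ^^ n) (scale p (\<alpha> r) + scale q (\<alpha> t)) =
    (case (rot_matrix (c r t) (c t r) ^^ n) (p, q) of (p', q') \<Rightarrow> scale p' (\<alpha> r) + scale q' (\<alpha> t))"
proof (induction n)
  case (Suc n)
  note D = refl_matrixD[OF R]
  obtain p' q' where pq: "(rot_matrix (c r t) (c t r) ^^ n) (p, q) = (p', q')"
    by fastforce
  have neg: "\<rho> r (\<alpha> r) = - \<alpha> r" "\<rho> t (\<alpha> t) = - \<alpha> t"
    using D(5,8) rt add_scale_minus_two by metis+
  have V: "scale x (\<alpha> r) \<in> V" "scale x (\<alpha> t) \<in> V" "\<alpha> r \<in> V" "\<alpha> t \<in> V" for x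
    using D(4,6) rt by (simp_all add: subspace_scale)
  have 1: "\<rho> t (scale p' (\<alpha> r) + scale q' (\<alpha> t)) = scale p' (\<alpha> r) + scale (c t r * p' - q') (\<alpha> t)"
    using linear_map_onD[OF lin(2)] D(8)[of t r] rt V
    by (simp add: neg scale_right_distrib scale_left_diff_distrib scale_minus_right mult.commute)
  have "\<rho> r (scale p' (\<alpha> r) + scale y (\<alpha> t)) = scale (c r t * y - p') (\<alpha> r) + scale y (\<alpha> t)" for y
    using linear_map_onD[OF lin(1)] D(8)[of r t] rt V
    by (simp add: neg scale_right_distrib scale_left_diff_distrib scale_minus_right mult.commute)
  from this[of "c t r * p' - q'"] have "\<rho> r (scale p' (\<alpha> r) + scale (c t r * p' - q') (\<alpha> t))
      = scale (c r t * (c t r * p' - q') - p') (\<alpha> r) + scale (c t r * p' - q') (\<alpha> t)" .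
  also have "c r t * (c t r * p' - q') - p' = (c r t * c t r - 1) * p' - c r t * q'"
    by (simp add: algebra_simps)
  finally show ?case
    using Suc 1 pq by (simp add: rot_matrix_def)
qed simp

text \<open>The relation for \<open>r\<close> and \<open>t\<close> makes \<open>rot_matrix\<close>
  periodic with period \<open>m r t\<close>. Finiteness of \<open>m r t\<close> enters here, since a
  value 0 would impose no condition.\<close>

lemma refl_matrix_parameter:
  assumes G: "group_representation W V \<rho>" and R: "refl_matrix S V \<rho> \<alpha> c"
    and rt: "r \<in> S" "t \<in> S" "r \<noteq> t"
  obtains k where "1 \<le> k" "2 * k \<le> m r t" "c r t * c t r = (two_cos (m r t) k)\<^sup>2"
    "two_cos (m r t) k = 0 \<Longrightarrow> c r t = 0 \<and> c t r = 0"
proof -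
  note D = refl_matrixD[OF R] and GD = group_representationD[OF G]
  have lin: "linear_map_on V V (\<rho> r)" "linear_map_on V V (\<rho> t)"
    using GD rt by auto
  have "(rot_matrix (c r t) (c t r) ^^ m r t) (p, q) = (p, q)" for p q
  proof -
    obtain p' q' where pq: "(rot_matrix (c r t) (c t r) ^^ m r t) (p, q) = (p', q')"
      by fastforce
    have "scale p (\<alpha> r) + scale q (\<alpha> t) \<in> V"
      using D(4,6) rt by (simp add: subspace_scale subspace_add)
    then have "scale p' (\<alpha> r) + scale q' (\<alpha> t) = scale p (\<alpha> r) + scale q (\<alpha> t)"
      using rep_pair_power[OF G rt] pair_power_eq_rot[OF R rt lin, of "m r t" p q] pq by simp
    then have "scale (p' - p) (\<alpha> r) + scale (q' - q) (\<alpha> t) = 0"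
      by (simp add: scale_left_diff_distrib algebra_simps)
    then have "p' - p = 0 \<and> q' - q = 0"
      by (rule independent_pair[OF D(2), rotated -1]) (use rt D(1) in \<open>auto dest: inj_onD\<close>)
    then show ?thesis
      using pq by simp
  qed
  then show thesis
    using rot_matrix_finite_order_imp[of "m r t" "c r t" "c t r"] m_nonzero[OF rt(1,2)] that
    by (metis gr0I surj_pair)
qed

section \<open>Isomorphisms and changes of basis\<close>

lemma equivariant_on_generators:
  assumes G: "group_representation W V \<rho>" and G': "group_representation W V' \<rho>'"
    and \<phi>: "\<And>x. x \<in> V \<Longrightarrow> \<phi> x \<in> V'"
    and gen: "\<And>s x. s \<in> S \<Longrightarrow> x \<in> V \<Longrightarrow> \<phi> (\<rho> s x) = \<rho>' s (\<phi> x)"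
    and w: "w \<in> carrier W" and x: "x \<in> V"
  shows "\<phi> (\<rho> w x) = \<rho>' w (\<phi> x)"
proof -
  note D = group_representationD[OF G] and D' = group_representationD[OF G']
  have "w \<in> generate W S"
    using w generate_S by simp
  then have "w \<in> carrier W \<and> (\<forall>x\<in>V. \<phi> (\<rho> w x) = \<rho>' w (\<phi> x))"
  proof (induction rule: generate.induct)
    case one
    then show ?case
      using D(3) D'(3) \<phi> by simp
  next
    case (incl h)
    then show ?case
      using gen by simp
  next
    case (inv h)
    have h: "h \<in> carrier W" "inv\<^bsub>W\<^esub> h \<in> carrier W"
      using inv by auto
    have "\<phi> (\<rho> (inv\<^bsub>W\<^esub> h) x) = \<rho>' (inv\<^bsub>W\<^esub> h) (\<phi> x)" if x: "x \<in> V" for x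
    proof -
      let ?y = "\<rho> (inv\<^bsub>W\<^esub> h) x"
      have y: "?y \<in> V"
        using linear_map_on_closed[OF D(2)[OF h(2)] x] .
      have "\<rho> h ?y = x"
        using D(3)[OF x] D(4)[OF h x] h by simp
      then have "\<phi> x = \<rho>' h (\<phi> ?y)"
        using gen[OF inv y] by simp
      then show ?thesis
        using D'(3)[OF \<phi>[OF y]] D'(4)[OF h(2,1) \<phi>[OF y]] h by simp
    qed
    then show ?case
      using h by simp
  next
    case (eng h1 h2)
    then show ?case
      using D(4) D'(4) \<phi> linear_map_on_closed[OF D(2)] by auto
  qed
  then show ?thesis
    using x by simp
qed

lemma refl_matrix_iso:
  assumes G: "group_representation W V \<rho>" and G': "group_representation W V' \<rho>'"
    and R: "refl_matrix S V \<rho> \<alpha> c" and R': "refl_matrix S V' \<rho>' \<alpha>' c'"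
    and x: "\<And>s. x s \<noteq> 0" and c': "\<And>s t. s \<in> S \<Longrightarrow> t \<in> S \<Longrightarrow> c' s t = c s t * (x t / x s)"
  shows "\<exists>\<phi>. linear_map_on V V' \<phi> \<and> bij_betw \<phi> V V' \<and>
    (\<forall>w\<in>carrier W. \<forall>x\<in>V. \<phi> (\<rho> w x) = \<rho>' w (\<phi> x))"
proof -
  note D = refl_matrixD[OF R] and D' = refl_matrixD[OF R']
    and GD = group_representationD[OF G] and GD' = group_representationD[OF G']
  \<comment> \<open>Rescaling the first basis by \<open>x\<close> turns its matrix into
    \<open>c'\<close>, so the isomorphism must send \<open>x s\<close> times
    \<open>\<alpha> s\<close> to \<open>\<alpha>' s\<close>; \<psi> is its inverse. Both are built
    on the ambient space and used only on \<open>V\<close> and \<open>V'\<close>.\<close>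
  obtain \<phi> where \<phi>: "Vector_Spaces.linear scale scale \<phi>"
    "\<And>b. b \<in> \<alpha> ` S \<Longrightarrow> \<phi> b = scale (1 / x (the_inv_into S \<alpha> b)) (\<alpha>' (the_inv_into S \<alpha> b))"
    using linear_extension[OF D(2), of "\<lambda>b. scale (1 / x (the_inv_into S \<alpha> b)) (\<alpha>' (the_inv_into S \<alpha> b))"]
    by blast
  obtain \<psi> where \<psi>: "Vector_Spaces.linear scale scale \<psi>"
    "\<And>b. b \<in> \<alpha>' ` S \<Longrightarrow> \<psi> b = scale (x (the_inv_into S \<alpha>' b)) (\<alpha> (the_inv_into S \<alpha>' b))"
    using linear_extension[OF D'(2), of "\<lambda>b. scale (x (the_inv_into S \<alpha>' b)) (\<alpha> (the_inv_into S \<alpha>' b))"]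
    by blast
  have \<phi>\<alpha>: "\<phi> (\<alpha> s) = scale (1 / x s) (\<alpha>' s)" and \<psi>\<alpha>: "\<psi> (\<alpha>' s) = scale (x s) (\<alpha> s)" if "s \<in> S" for s
    using \<phi>(2) \<psi>(2) that the_inv_into_f_f[OF D(1)] the_inv_into_f_f[OF D'(1)] by auto
  have L\<phi>: "linear_map_on V V' \<phi>"
  proof -
    have "\<phi> b \<in> V'" if "b \<in> \<alpha> ` S" for b
      using that \<phi>\<alpha> subspace_scale[OF D'(4) D'(6)] by auto
    then show ?thesis
      using linear_imp_linear_map_on[OF \<phi>(1) _ D'(4), of "\<alpha> ` S"] D(3) by auto
  qed
  have L\<psi>: "linear_map_on V' V \<psi>"
  proof -
    have "\<psi> b \<in> V" if "b \<in> \<alpha>' ` S" for b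
      using that \<psi>\<alpha> subspace_scale[OF D(4) D(6)] by auto
    then show ?thesis
      using linear_imp_linear_map_on[OF \<psi>(1) _ D(4), of "\<alpha>' ` S"] D'(3) by auto
  qed
  have id: "linear_map_on V V (\<lambda>x. x)" "linear_map_on V' V' (\<lambda>x. x)"
    by (auto simp: linear_map_on_def)
  have "\<psi> (\<phi> y) = y" if "y \<in> V" for y
  proof (rule linear_map_on_eq_on_span[of "\<alpha> ` S" V "\<lambda>y. \<psi> (\<phi> y)" V "\<lambda>y. y"])
    show "linear_map_on (span (\<alpha> ` S)) V (\<lambda>y. \<psi> (\<phi> y))"
      unfolding D(3) by (rule linear_map_on_compose[OF L\<phi> L\<psi>])
    show "linear_map_on (span (\<alpha> ` S)) V (\<lambda>y. y)"
      using D(3) id by simp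
    show "y \<in> span (\<alpha> ` S)"
      using that D(3) by simp
    show "\<psi> (\<phi> b) = b" if "b \<in> \<alpha> ` S" for b
      using that \<phi>\<alpha> \<psi>\<alpha> D'(6) x linear_map_on_scale[OF L\<psi>] by auto
  qed
  moreover have "\<phi> (\<psi> y) = y" if "y \<in> V'" for y
  proof (rule linear_map_on_eq_on_span[of "\<alpha>' ` S" V' "\<lambda>y. \<phi> (\<psi> y)" V' "\<lambda>y. y"])
    show "linear_map_on (span (\<alpha>' ` S)) V' (\<lambda>y. \<phi> (\<psi> y))"
      unfolding D'(3) by (rule linear_map_on_compose[OF L\<psi> L\<phi>])
    show "linear_map_on (span (\<alpha>' ` S)) V' (\<lambda>y. y)"
      using D'(3) id by simp
    show "y \<in> span (\<alpha>' ` S)"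
      using that D'(3) by simp
    show "\<phi> (\<psi> b) = b" if "b \<in> \<alpha>' ` S" for b
      using that \<psi>\<alpha> \<phi>\<alpha> D(6) x linear_map_on_scale[OF L\<phi>] by auto
  qed
  ultimately have bij: "bij_betw \<phi> V V'"
    using linear_map_on_closed[OF L\<phi>] linear_map_on_closed[OF L\<psi>]
    by (intro bij_betw_byWitness[of _ \<psi>]) auto
  have gen: "\<phi> (\<rho> s y) = \<rho>' s (\<phi> y)" if s: "s \<in> S" and y: "y \<in> V" for s y
  proof (rule linear_map_on_eq_on_span[of "\<alpha> ` S" V' "\<lambda>y. \<phi> (\<rho> s y)" V' "\<lambda>y. \<rho>' s (\<phi> y)"])
    have ls: "linear_map_on V V (\<rho> s)" "linear_map_on V' V' (\<rho>' s)"
      using GD(2) GD'(2) s by auto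
    show "linear_map_on (span (\<alpha> ` S)) V' (\<lambda>y. \<phi> (\<rho> s y))"
      "linear_map_on (span (\<alpha> ` S)) V' (\<lambda>y. \<rho>' s (\<phi> y))"
      unfolding D(3) using L\<phi> ls by (blast intro: linear_map_on_compose)+
    show "y \<in> span (\<alpha> ` S)"
      using y D(3) by simp
    fix b assume "b \<in> \<alpha> ` S"
    then obtain t where t: "t \<in> S" "b = \<alpha> t"
      by blast
    have "\<phi> (\<rho> s b) = scale (1 / x t) (\<alpha>' t) + scale (c s t / x s) (\<alpha>' s)"
      using s t D \<phi>\<alpha> linear_map_onD[OF L\<phi>] by (simp add: subspace_scale)
    also have "c s t / x s = c' s t / x t"
      using c'[OF s t(1)] x by (simp add: field_simps)
    also have "scale (1 / x t) (\<alpha>' t) + scale (c' s t / x t) (\<alpha>' s) = \<rho>' s (\<phi> b)"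
      using s t D' \<phi>\<alpha> linear_map_onD[OF ls(2)] by (simp add: scale_right_distrib)
    finally show "\<phi> (\<rho> s b) = \<rho>' s (\<phi> b)" .
  qed
  have "\<phi> (\<rho> w y) = \<rho>' w (\<phi> y)" if "w \<in> carrier W" "y \<in> V" for w y
    by (rule equivariant_on_generators[where \<phi> = \<phi>, OF G G' linear_map_on_closed[OF L\<phi>] gen that])
  with L\<phi> bij show ?thesis
    by blast
qed

text \<open>An isomorphism carries the basis along without changing the matrix, so whatever is
  computed from \<open>c\<close> is an invariant of the isomorphism class.\<close>

lemma refl_matrix_transport:
  assumes R: "refl_matrix S V \<rho> \<alpha> c"
    and \<phi>: "linear_map_on V V' \<phi>" "bij_betw \<phi> V V'"
    and equi: "\<And>s x. s \<in> S \<Longrightarrow> x \<in> V \<Longrightarrow> \<phi> (\<rho> s x) = \<rho>' s (\<phi> x)"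
  shows "refl_matrix S V' \<rho>' (\<phi> \<circ> \<alpha>) c"
proof -
  note D = refl_matrixD[OF R]
  \<comment> \<open>The map \<phi> is linear only on \<open>V\<close>. A globally linear
    \<open>g\<close> agreeing with it there gives access to the library facts on images of spans and
    of independent sets.\<close>
  obtain g where g: "Vector_Spaces.linear scale scale g" "\<And>b. b \<in> \<alpha> ` S \<Longrightarrow> g b = \<phi> b"
    using linear_extension[OF D(2), of \<phi>] by blast
  interpret g: Vector_Spaces.linear scale scale g
    by (rule g(1))
  have "linear_map_on (span (\<alpha> ` S)) UNIV g"
    using g(1) by (intro linear_imp_linear_map_on) (auto simp: subspace_UNIV)
  then have g\<phi>: "g y = \<phi> y" if "y \<in> V" for y
    using linear_map_on_eq_on_span[of "\<alpha> ` S" UNIV g V' \<phi> y] \<phi>(1) D(3) g(2) that by blast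
  have im: "(\<phi> \<circ> \<alpha>) ` S = g ` (\<alpha> ` S)"
    using g(2) by (auto simp: image_iff)
  have inj: "inj_on g (span (\<alpha> ` S))"
    using \<phi>(2) D(3) g\<phi> by (auto simp: bij_betw_def inj_on_def)
  have "independent ((\<phi> \<circ> \<alpha>) ` S)"
    unfolding im by (rule g.independent_injective_image[OF D(2) inj])
  moreover have "span ((\<phi> \<circ> \<alpha>) ` S) = V'"
    unfolding im g.span_image D(3) using \<phi>(2) g\<phi> by (auto simp: bij_betw_def)
  moreover have "inj_on (\<phi> \<circ> \<alpha>) S"
    using D(1,6) \<phi>(2) by (auto simp: bij_betw_def inj_on_def)
  moreover have "\<rho>' s ((\<phi> \<circ> \<alpha>) t) = (\<phi> \<circ> \<alpha>) t + scale (c s t) ((\<phi> \<circ> \<alpha>) s)" if "s \<in> S" "t \<in> S" for s t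
    using equi[OF that(1), of "\<alpha> t", symmetric] that D linear_map_onD[OF \<phi>(1)] by (simp add: subspace_scale)
  ultimately show ?thesis
    using D(5) by (auto simp: refl_matrix_def)
qed

text \<open>The displacement of \<open>\<alpha>' s\<close> under \<open>s\<close> is -2 times itself
  and also a multiple of \<open>\<alpha> s\<close>, so corresponding basis vectors are
  proportional.\<close>

lemma refl_matrix_gauge:
  assumes G: "group_representation W V \<rho>"
    and R: "refl_matrix S V \<rho> \<alpha> c" and R': "refl_matrix S V \<rho> \<alpha>' c'"
  obtains x where "\<And>s. x s \<noteq> 0" "\<And>s t. s \<in> S \<Longrightarrow> t \<in> S \<Longrightarrow> c' s t = c s t * (x t / x s)"
proof -
  note D = refl_matrixD[OF R] and D' = refl_matrixD[OF R'] and GD = group_representationD[OF G]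
  have "\<exists>x. x \<noteq> 0 \<and> \<alpha>' s = scale x (\<alpha> s)" if s: "s \<in> S" for s
  proof -
    obtain k where "\<rho> s (\<alpha>' s) = \<alpha>' s + scale k (\<alpha> s)"
      using reflection_displacement[OF R GD(2) s D'(6)[OF s]] s by auto
    then have "scale (-2) (\<alpha>' s) = scale k (\<alpha> s)"
      using D'(5,8)[OF s] s by simp
    then have "scale (- 1 / 2) (scale (-2) (\<alpha>' s)) = scale (- 1 / 2) (scale k (\<alpha> s))"
      by simp
    then have "\<alpha>' s = scale (- k / 2) (\<alpha> s)"
      by simp
    moreover from this have "- k / 2 \<noteq> 0"
      using D'(7)[OF s] by auto
    ultimately show ?thesis
      by blast
  qed
  then obtain y where y: "\<And>s. s \<in> S \<Longrightarrow> y s \<noteq> 0 \<and> \<alpha>' s = scale (y s) (\<alpha> s)"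
    by metis
  \<comment> \<open>The value 1 outside \<open>S\<close> makes \<open>x\<close> nowhere zero, as
    required by the unrestricted condition on \<open>x\<close>.\<close>
  define x where "x s = (if s \<in> S then y s else 1)" for s
  have x: "x s \<noteq> 0" "s \<in> S \<Longrightarrow> \<alpha>' s = scale (x s) (\<alpha> s)" for s
    using y by (auto simp: x_def)
  have "c' s t = c s t * (x t / x s)" if st: "s \<in> S" "t \<in> S" for s t
  proof -
    have "\<rho> s (\<alpha>' t) = scale (x t) (\<alpha> t + scale (c s t) (\<alpha> s))"
      using st x(2) D linear_map_on_scale[OF GD(2)[of s]] by simp
    moreover have "\<rho> s (\<alpha>' t) = scale (x t) (\<alpha> t) + scale (c' s t * x s) (\<alpha> s)"
      using st x(2) D'(8)[of s t] by simp
    ultimately have "scale (x t * c s t) (\<alpha> s) = scale (c' s t * x s) (\<alpha> s)"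
      by (auto simp: scale_right_distrib)
    then have "x t * c s t = c' s t * x s"
      using D(7)[OF st(1)] by (metis scale_cancel_right)
    then show ?thesis
      using x(1) by (simp add: field_simps)
  qed
  with x(1) show thesis
    by (rule that)
qed

section \<open>Realizing a matrix by a representation\<close>

text \<open>The reflections prescribed by \<open>c\<close> are defined on the span of
  \<open>B\<close>. Once they satisfy the Coxeter relations, the action of words on \<open>V\<close>
  is invariant under \<open>word_equiv\<close> and descends to the group.\<close>

lemma representation_exists:
  assumes B: "finite B" "card B = card S" "independent B"
    and diag: "\<And>s. s \<in> S \<Longrightarrow> c s s = -2"
    and off: "\<And>r t. \<lbrakk>r \<in> S; t \<in> S; r \<noteq> t\<rbrakk> \<Longrightarrow> \<exists>k. 1 \<le> k \<and> 2 * k \<le> m r t \<and>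
      c r t * c t r = (two_cos (m r t) k)\<^sup>2 \<and> (two_cos (m r t) k = 0 \<longrightarrow> c r t = 0 \<and> c t r = 0)"
  obtains V \<rho> \<alpha> where "group_representation W V \<rho>" "refl_matrix S V \<rho> \<alpha> c"
proof -
  obtain \<alpha> where \<alpha>: "bij_betw \<alpha> S B"
    using finite_same_card_bij[OF finite_S B(1)] B(2) by auto
  define V where "V = span B"
  \<comment> \<open>Derivations in \<^const>\<open>word_equiv\<close> may pass through letters outside \<open>S\<close>, so these have to act too.\<close>
  define R where "R s = (if s \<in> S then SOME g. Vector_Spaces.linear scale scale g \<and>
    (\<forall>t\<in>S. g (\<alpha> t) = \<alpha> t + scale (c s t) (\<alpha> s)) else (\<lambda>x. x))" for s
  have R: "Vector_Spaces.linear scale scale (R s) \<and> (\<forall>t\<in>S. R s (\<alpha> t) = \<alpha> t + scale (c s t) (\<alpha> s))"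
    if s: "s \<in> S" for s
  proof -
    obtain g where g: "Vector_Spaces.linear scale scale g"
      "\<And>b. b \<in> B \<Longrightarrow> g b = b + scale (c s (the_inv_into S \<alpha> b)) (\<alpha> s)"
      using linear_extension[OF B(3), of "\<lambda>b. b + scale (c s (the_inv_into S \<alpha> b)) (\<alpha> s)"] by blast
    have "g (\<alpha> t) = \<alpha> t + scale (c s t) (\<alpha> s)" if "t \<in> S" for t
      using g(2)[of "\<alpha> t"] \<alpha> that the_inv_into_f_f[of \<alpha> S t] by (auto simp: bij_betw_def)
    then show ?thesis
      unfolding R_def using s someI[of "\<lambda>g. Vector_Spaces.linear scale scale g \<and>
        (\<forall>t\<in>S. g (\<alpha> t) = \<alpha> t + scale (c s t) (\<alpha> s))" g] g(1) by simp
  qed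
  have \<alpha>B: "\<alpha> ` S = B" "inj_on \<alpha> S"
    using \<alpha> by (auto simp: bij_betw_def)
  have M: "refl_matrix S V R \<alpha> c"
    using \<alpha>B B(3) R diag by (auto simp: refl_matrix_def V_def)
  note D = refl_matrixD[OF M]
  have lin: "linear_map_on V V (R s)" for s
  proof (cases "s \<in> S")
    case True
    have "R s b \<in> V" if "b \<in> B" for b
    proof -
      obtain t where "t \<in> S" "b = \<alpha> t"
        using \<open>b \<in> B\<close> \<alpha>B by blast
      then show ?thesis
        using D(4,6,8) True by (simp add: subspace_add subspace_scale)
    qed
    then show ?thesis
      using linear_imp_linear_map_on[of "R s" B V] R[OF True] D(4) by (simp add: V_def)
  next
    case False
    then show ?thesis
      by (simp add: R_def linear_map_on_def)
  qed
  have idV: "linear_map_on V V (\<lambda>x. x)"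
    by (simp add: linear_map_on_def)
  have ext: "f x = x" if "linear_map_on V V f" "\<And>t. t \<in> S \<Longrightarrow> f (\<alpha> t) = \<alpha> t" "x \<in> V" for f x
    by (rule linear_map_on_eq_on_span[of B V f V "\<lambda>x. x"]) (use that idV \<alpha>B in \<open>auto simp: V_def\<close>)
  have involution: "R s (R s x) = x" if s: "s \<in> S" and x: "x \<in> V" for s x
  proof (rule ext[OF linear_map_on_compose[OF lin lin] _ x])
    fix t assume t: "t \<in> S"
    have "R s (R s (\<alpha> t)) = (\<alpha> t + scale (c s t) (\<alpha> s)) + scale (c s t) (\<alpha> s + scale (-2) (\<alpha> s))"
      using s t D(4-6,8) linear_map_onD[OF lin[of s]] by (simp add: subspace_scale)
    also have "\<dots> = \<alpha> t"
      unfolding add_scale_minus_two by (simp add: scale_minus_right)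
    finally show "R s (R s (\<alpha> t)) = \<alpha> t" .
  qed
  have braid: "((\<lambda>y. R r (R t y)) ^^ m r t) x = x"
    if rt: "r \<in> S" "t \<in> S" "r \<noteq> t" and x: "x \<in> V" for r t x
  proof -
    let ?T = "\<lambda>y. R r (R t y)"
    obtain k where k: "1 \<le> k" "2 * k \<le> m r t" "c r t * c t r = (two_cos (m r t) k)\<^sup>2"
      "two_cos (m r t) k = 0 \<Longrightarrow> c r t = 0 \<and> c t r = 0"
      using off[OF rt] by blast
    have linT: "linear_map_on V V (?T ^^ n)" for n
    proof (induction n)
      case (Suc n)
      then show ?case
        using linear_map_on_compose[OF Suc linear_map_on_compose[OF lin[of t] lin[of r]]]
        by (simp add: comp_def)
    qed (use idV in \<open>simp add: id_def\<close>)
    have plane: "(?T ^^ m r t) (scale p (\<alpha> r) + scale q (\<alpha> t)) = scale p (\<alpha> r) + scale q (\<alpha> t)" for p q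
      using pair_power_eq_rot[OF M rt lin lin, of "m r t" p q] rot_matrix_finite_order[OF k] by simp
    \<comment> \<open>As \<open>c\<^sub>r\<^sub>t c\<^sub>t\<^sub>r \<noteq> 4\<close>, every \<open>\<alpha>\<^sub>u\<close> can be moved by a vector of the plane to a common fixed vector of \<open>r\<close> and \<open>t\<close>.\<close>
    show ?thesis
    proof (rule ext[OF linT _ x])
      fix u assume u: "u \<in> S"
      have "4 - c r t * c t r \<noteq> 0"
        using two_cos_power2_neq_4[OF k(1,2)] k(3) by simp
      then obtain p q where pq: "c r u - 2 * p + c r t * q = 0" "c t u + c t r * p - 2 * q = 0"
      \<comment> \<open>Cramer's rule for the two equations saying that
        \<alpha>\<open>u + p\<close>\<alpha>\<open>r + q\<close>\<alpha>\<open>t\<close> is fixed by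
        \<open>r\<close> and by \<open>t\<close>; the determinant is
        \<open>?\<Delta>\<close>.\<close>
      proof (intro that)
        let ?\<Delta> = "4 - c r t * c t r"
        let ?p = "(2 * c r u + c r t * c t u) / ?\<Delta>" and ?q = "(2 * c t u + c t r * c r u) / ?\<Delta>"
        assume "?\<Delta> \<noteq> 0"
        then show "c r u - 2 * ?p + c r t * ?q = 0" "c t u + c t r * ?p - 2 * ?q = 0"
          by (simp_all add: divide_simps) (simp_all add: algebra_simps)
      qed
      define y where "y = scale p (\<alpha> r) + scale q (\<alpha> t)"
      define z where "z = \<alpha> u + y"
      have V: "y \<in> V" "z \<in> V" "\<alpha> u \<in> V" "scale p (\<alpha> r) \<in> V" "scale q (\<alpha> t) \<in> V" "\<alpha> r \<in> V" "\<alpha> t \<in> V"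
        using D(4,6) rt u by (auto simp: y_def z_def intro!: subspace_add subspace_scale)
      have "R r z = \<alpha> u + scale (c r u) (\<alpha> r) + (scale p (\<alpha> r + scale (-2) (\<alpha> r)) + scale q (\<alpha> t + scale (c r t) (\<alpha> r)))"
        using V rt u D(4,5,8) linear_map_onD[OF lin[of r]] by (simp add: z_def y_def subspace_add)
      also have "\<dots> = z + scale (c r u - 2 * p + c r t * q) (\<alpha> r)"
        by (simp add: z_def y_def scale_right_distrib scale_left_distrib scale_left_diff_distrib
            scale_minus_right mult.commute algebra_simps)
      finally have Rr: "R r z = z"
        using pq by simp
      have "R t z = \<alpha> u + scale (c t u) (\<alpha> t) + (scale p (\<alpha> r + scale (c t r) (\<alpha> t)) + scale q (\<alpha> t + scale (-2) (\<alpha> t)))"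
        using V rt u D(4,5,8) linear_map_onD[OF lin[of t]] by (simp add: z_def y_def subspace_add)
      also have "\<dots> = z + scale (c t u + c t r * p - 2 * q) (\<alpha> t)"
        by (simp add: z_def y_def scale_right_distrib scale_left_distrib scale_left_diff_distrib
            scale_minus_right mult.commute algebra_simps)
      finally have Rt: "R t z = z"
        using pq by simp
      have "(?T ^^ n) z = z" for n
        by (induction n) (simp_all add: Rr Rt)
      moreover have "(?T ^^ m r t) z = (?T ^^ m r t) (\<alpha> u) + (?T ^^ m r t) y"
        using linear_map_on_add[OF linT V(3,1)] by (simp add: z_def)
      ultimately show "(?T ^^ m r t) (\<alpha> u) = \<alpha> u"
        using plane[of p q] by (simp add: y_def z_def)
    qed
  qed
  \<comment> \<open>The sign of a letter is ignored: generators act on \<open>V\<close> as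
    involutions, so a letter and its formal inverse act alike.\<close>
  define act where "act u = foldr (\<lambda>(s, b). R s) u" for u :: "'g word"
  have act_append: "act (u @ v) x = act u (act v x)" for u v x
    by (simp add: act_def)
  have act_lin: "linear_map_on V V (act u)" for u
  proof (induction u)
    case Nil
    then show ?case
      using idV by (simp add: act_def id_def)
  next
    case (Cons a u)
    then show ?case
      using linear_map_on_compose[OF Cons lin[of "fst a"]]
      by (simp add: act_def comp_def case_prod_beta)
  qed
  have act_pair: "act (pair_word r t n) x = ((\<lambda>y. R r (R t y)) ^^ n) x" for r t n x
    by (induction n) (simp_all add: act_def)
  have act_equiv: "act u x = act v x" if "word_equiv S (coxeter_relators S m) u v" "x \<in> V" for u v x
    using that
  proof (induction arbitrary: x rule: word_equiv.induct)
    case (cong u v p q)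
    then show ?case
      using linear_map_on_closed[OF act_lin] by (simp add: act_append)
  next
    case (cancel s b)
    then show ?case
      using involution by (simp add: act_def)
  next
    case (relator r)
    then consider s where "s \<in> S" "r = [(s, False), (s, False)]"
      | s t where "s \<in> S" "t \<in> S" "s \<noteq> t" "r = pair_word s t (m s t)"
      by (auto simp: coxeter_relators_def)
    then show ?case
    proof cases
      case 1
      then show ?thesis
        using involution relator(2) by (simp add: act_def)
    next
      case 2
      then show ?thesis
        using braid[OF 2(1-3) relator(2)] act_pair by (simp add: act_def)
    qed
  qed auto
  \<comment> \<open>A group element acts through an arbitrarily chosen word for it; the presentation
    and \<open>act_equiv\<close> make the action on \<open>V\<close> independent of that
    choice.\<close>
  define \<rho> where "\<rho> w = act (SOME u. u \<in> lists (S \<times> UNIV) \<and> word_value W u = w)" for w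
  have \<rho>: "\<rho> (word_value W u) x = act u x" if u: "u \<in> lists (S \<times> UNIV)" and x: "x \<in> V" for u x
  proof -
    let ?v = "SOME v. v \<in> lists (S \<times> UNIV) \<and> word_value W v = word_value W u"
    have v: "?v \<in> lists (S \<times> UNIV) \<and> word_value W ?v = word_value W u"
      by (rule someI[of _ u]) (use u in simp)
    then have "word_equiv S (coxeter_relators S m) ?v u"
      using word_value_eq_iff u by blast
    then show ?thesis
      unfolding \<rho>_def using x by (rule act_equiv)
  qed
  have rep: "group_representation W V \<rho>"
    unfolding group_representation_def
  proof (intro conjI ballI)
    show "subspace V"
      by (rule D(4))
    show "linear_map_on V V (\<rho> w)" for w
      unfolding \<rho>_def by (rule act_lin)
    show "\<rho> \<one>\<^bsub>W\<^esub> x = x" if "x \<in> V" for x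
      using \<rho>[of "[]" x] that by (simp add: act_def)
    fix w w' x assume w: "w \<in> carrier W" "w' \<in> carrier W" and x: "x \<in> V"
    obtain u v where u: "u \<in> lists (S \<times> UNIV)" "word_value W u = w"
      and v: "v \<in> lists (S \<times> UNIV)" "word_value W v = w'"
      using ex_word_value w by meson
    have "\<rho> (w \<otimes>\<^bsub>W\<^esub> w') x = act (u @ v) x"
      using \<rho>[of "u @ v" x] u v x word_value_append[OF u(1) v(1)] by simp
    also have "\<dots> = \<rho> w (\<rho> w' x)"
      using \<rho>[OF u(1)] \<rho>[OF v(1)] u v x linear_map_on_closed[OF act_lin] by (simp add: act_append)
    finally show "\<rho> (w \<otimes>\<^bsub>W\<^esub> w') x = \<rho> w (\<rho> w' x)" .
  qed
  have "\<rho> s x = R s x" if "s \<in> S" "x \<in> V" for s x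
    using \<rho>[of "[(s, False)]" x] that by (simp add: act_def)
  then have "refl_matrix S V \<rho> \<alpha> c"
    using M D(6) by (simp add: refl_matrix_def)
  with rep show thesis
    by (rule that)
qed

section \<open>The data attached to a matrix\<close>

definition valid_exponents :: "('g \<times> 'g \<Rightarrow> nat) \<Rightarrow> bool" where
  "valid_exponents k \<longleftrightarrow> k \<in> extensional (off_diagonal S) \<and>
     (\<forall>r\<in>S. \<forall>t\<in>S. r \<noteq> t \<longrightarrow> k (r, t) = k (t, r) \<and> 1 \<le> k (r, t) \<and> 2 * k (r, t) \<le> m r t)"

definition edge_two_cos :: "('g \<times> 'g \<Rightarrow> nat) \<Rightarrow> 'g \<Rightarrow> 'g \<Rightarrow> complex" where
  "edge_two_cos k r t = two_cos (m r t) (k (r, t))"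

text \<open>Restates \<open>has_data\<close> in terms of the matrix alone. The value of
  \<open>f\<close> on an edge stands for \<open>a t r / a r t\<close>, so the edge equation is the
  formula for \<open>c r t\<close> with denominators cleared; the first clause also covers the pairs
  that are not edges.\<close>

definition matches where
  "matches k \<chi> c \<longleftrightarrow>
     (\<forall>r\<in>S. \<forall>t\<in>S. r \<noteq> t \<longrightarrow> c r t * c t r = (edge_two_cos k r t)\<^sup>2 \<and> (edge_two_cos k r t = 0 \<longrightarrow> c r t = 0)) \<and>
     (\<exists>f \<in> hom (chains1 (tilde_edges S m k)) complex_units.
        (\<forall>(r, t) \<in> tilde_edges S m k. c r t * f (edge_chain (tilde_edges S m k) r t) = edge_two_cos k r t) \<and>
        \<chi> = restrict f (carrier (H1 S (tilde_edges S m k))))"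

lemma matchesE:
  assumes "matches k \<chi> c"
  obtains f where "f \<in> hom (chains1 (tilde_edges S m k)) complex_units"
    "\<chi> = restrict f (carrier (H1 S (tilde_edges S m k)))"
    "\<And>r t. (r, t) \<in> tilde_edges S m k \<Longrightarrow> c r t * f (edge_chain (tilde_edges S m k) r t) = edge_two_cos k r t"
  using assms unfolding matches_def by blast

lemma valid_exponentsD:
  assumes "valid_exponents k" "r \<in> S" "t \<in> S" "r \<noteq> t"
  shows "k (r, t) = k (t, r)" "1 \<le> k (r, t)" "2 * k (r, t) \<le> m r t"
  using assms by (auto simp: valid_exponents_def)

lemma edge_two_cos_commute: "valid_exponents k \<Longrightarrow> r \<in> S \<Longrightarrow> t \<in> S \<Longrightarrow> r \<noteq> t \<Longrightarrow> edge_two_cos k r t = edge_two_cos k t r"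
  using valid_exponentsD(1)[of k r t] m_commute[of r t] by (simp add: edge_two_cos_def)

lemma tilde_edges_iff:
  assumes "valid_exponents k"
  shows "(r, t) \<in> tilde_edges S m k \<longleftrightarrow> r \<in> S \<and> t \<in> S \<and> r \<noteq> t \<and> edge_two_cos k r t \<noteq> 0"
  using valid_exponentsD[OF assms, of r t] three_le_reduced_order_iff[of "k (r, t)" "m r t"]
    two_cos_eq_0_iff[of "k (r, t)" "m r t"]
  by (auto simp: tilde_edges_def off_diagonal_def edge_two_cos_def)

lemma symmetric_edges_tilde:
  assumes "valid_exponents k"
  shows "symmetric_edges S (tilde_edges S m k)"
proof
  show "tilde_edges S m k \<subseteq> S \<times> S"
    by (auto simp: tilde_edges_iff[OF assms])
  show "sym (tilde_edges S m k)"
    using edge_two_cos_commute[OF assms] by (auto simp: tilde_edges_iff[OF assms] intro!: symI)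
qed

lemma IR_data_iff:
  "(k, \<chi>) \<in> IR_data S m \<longleftrightarrow> valid_exponents k \<and> \<chi> \<in> characters (H1 S (tilde_edges S m k))"
  unfolding IR_data_def valid_exponents_def off_diagonal_def by auto

lemma matches_in_IR_data:
  assumes "valid_exponents k" "matches k \<chi> c"
  shows "(k, \<chi>) \<in> IR_data S m"
  using assms symmetric_edges.hom_restrict_H1[OF symmetric_edges_tilde[OF assms(1)]]
  by (auto simp: IR_data_iff matches_def)

lemma matches_exists:
  assumes "group_representation W V \<rho>" "refl_matrix S V \<rho> \<alpha> c"
  shows "\<exists>k \<chi>. valid_exponents k \<and> matches k \<chi> c"
proof -
  \<comment> \<open>The predicate is unchanged when \<open>r\<close> and \<open>t\<close> are
    exchanged together with their coefficients, so \<open>SOME\<close> picks the same exponent for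
    \<open>(r, t)\<close> and \<open>(t, r)\<close>.\<close>
  define P where "P n x y j \<longleftrightarrow> 1 \<le> j \<and> 2 * j \<le> n \<and> x * y = (two_cos n j)\<^sup>2 \<and>
    (two_cos n j = 0 \<longrightarrow> x = 0 \<and> y = 0)" for n j :: nat and x y :: complex
  define k where "k = (\<lambda>(r, t) \<in> off_diagonal S. SOME j. P (m r t) (c r t) (c t r) j)"
  have k: "P (m r t) (c r t) (c t r) (k (r, t))" if rt: "r \<in> S" "t \<in> S" "r \<noteq> t" for r t
  proof -
    have "\<exists>j. P (m r t) (c r t) (c t r) j"
      by (rule refl_matrix_parameter[OF assms rt]) (auto simp: P_def)
    from someI_ex[OF this] show ?thesis
      using rt by (simp add: k_def off_diagonal_def)
  qed
  note k = k[unfolded P_def]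
  have "k (r, t) = k (t, r)" if rt: "r \<in> S" "t \<in> S" "r \<noteq> t" for r t
  proof -
    have "P (m r t) (c r t) (c t r) = P (m t r) (c t r) (c r t)"
      using m_commute[OF rt(1,2)] by (auto simp: P_def mult.commute)
    then show ?thesis
      using rt by (simp add: k_def off_diagonal_def)
  qed
  then have valid: "valid_exponents k"
    using k by (auto simp: valid_exponents_def k_def)
  let ?E = "tilde_edges S m k"
  interpret symmetric_edges S ?E
    by (rule symmetric_edges_tilde[OF valid])
  have c0: "c r t \<noteq> 0" if "(r, t) \<in> ?E" for r t
    using that k[of r t] by (auto simp: tilde_edges_iff[OF valid] edge_two_cos_def)
  have "(edge_two_cos k r t / c r t) * (edge_two_cos k t r / c t r) = 1" if "(r, t) \<in> ?E" for r t
    using that c0[OF that] c0[OF reversed[OF that]] k[of r t] edge_two_cos_commute[OF valid, of r t]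
    by (simp add: tilde_edges_iff[OF valid] edge_two_cos_def power2_eq_square)
  then obtain f where f: "f \<in> hom (chains1 ?E) complex_units"
    "\<And>r t. (r, t) \<in> ?E \<Longrightarrow> f (edge_chain ?E r t) = edge_two_cos k r t / c r t"
    using edge_function_extends[of "\<lambda>r t. edge_two_cos k r t / c r t"] by metis
  have "matches k (restrict f (carrier (H1 S ?E))) c"
    unfolding matches_def using k f c0 by (auto simp: edge_two_cos_def intro!: bexI[of _ f])
  with valid show ?thesis
    by blast
qed

text \<open>A gauge change leaves the products \<open>c r t * c t r\<close> alone, which fixes the
  exponents, and multiplies the edge values by a coboundary, which is invisible on cycles.\<close>

lemma matches_unique:
  assumes k: "valid_exponents k" "matches k \<chi> c" and k': "valid_exponents k'" "matches k' \<chi>' c'"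
    and x: "\<And>s. x s \<noteq> 0" "\<And>s t. s \<in> S \<Longrightarrow> t \<in> S \<Longrightarrow> c' s t = c s t * (x t / x s)"
  shows "k = k' \<and> \<chi> = \<chi>'"
proof -
  have "k p = k' p" if p: "p \<in> off_diagonal S" for p
  proof -
    obtain r t where rt: "p = (r, t)" "r \<in> S" "t \<in> S" "r \<noteq> t"
      using p by (auto simp: off_diagonal_def)
    have "(edge_two_cos k' r t)\<^sup>2 = c' r t * c' t r"
      using k'(2) rt by (auto simp: matches_def)
    also have "\<dots> = c r t * c t r"
      unfolding x(2)[OF rt(2,3)] x(2)[OF rt(3,2)] using x(1)[of r] x(1)[of t] by simp
    also have "\<dots> = (edge_two_cos k r t)\<^sup>2"
      using k(2) rt by (auto simp: matches_def)
    finally show ?thesis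
      using two_cos_power2_inj[of "k (r, t)" "m r t" "k' (r, t)"]
        valid_exponentsD[OF k(1) rt(2-4)] valid_exponentsD[OF k'(1) rt(2-4)] rt(1)
      by (simp add: edge_two_cos_def)
  qed
  then have kk: "k = k'"
    using k(1) k'(1) by (auto simp: valid_exponents_def intro: extensionalityI)
  let ?E = "tilde_edges S m k"
  interpret symmetric_edges S ?E
    by (rule symmetric_edges_tilde[OF k(1)])
  obtain f where f: "f \<in> hom (chains1 ?E) complex_units" "\<chi> = restrict f (carrier (H1 S ?E))"
    "\<And>r t. (r, t) \<in> ?E \<Longrightarrow> c r t * f (edge_chain ?E r t) = edge_two_cos k r t"
    using k(2) by (rule matchesE) blast
  obtain f' where f': "f' \<in> hom (chains1 ?E) complex_units" "\<chi>' = restrict f' (carrier (H1 S ?E))"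
    "\<And>r t. (r, t) \<in> ?E \<Longrightarrow> c' r t * f' (edge_chain ?E r t) = edge_two_cos k r t"
    using k'(2) unfolding kk[symmetric] by (rule matchesE) blast
  have "f' (edge_chain ?E r t) = f (edge_chain ?E r t) * (x r / x t)" if e: "(r, t) \<in> ?E" for r t
  proof -
    have "r \<in> S" "t \<in> S" "edge_two_cos k r t \<noteq> 0"
      using e by (auto simp: tilde_edges_iff[OF k(1)])
    then have "c r t \<noteq> 0" "c r t * (x t / x r) * f' (edge_chain ?E r t) = c r t * f (edge_chain ?E r t)"
      using f(3)[OF e] f'(3)[OF e] x(2)[of r t] by auto
    then show ?thesis
      using x(1) by (simp add: field_simps)
  qed
  then have "\<chi> = \<chi>'"
    unfolding f(2) f'(2) restrict_H1_eq_iff[OF f(1) f'(1)] using x(1) by blast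
  with kk show ?thesis
    by simp
qed

text \<open>Equal characters yield a potential by \<open>restrict_H1_eq_iff\<close>, which settles
  the edges. On the diagonal both matrices are -2, and on the remaining pairs both vanish.\<close>

lemma matches_gauge:
  assumes k: "valid_exponents k" and c: "matches k \<chi> c" and c': "matches k \<chi> c'"
    and diag: "\<And>s. s \<in> S \<Longrightarrow> c s s = -2" "\<And>s. s \<in> S \<Longrightarrow> c' s s = -2"
  obtains x where "\<And>s. x s \<noteq> 0" "\<And>s t. s \<in> S \<Longrightarrow> t \<in> S \<Longrightarrow> c' s t = c s t * (x t / x s)"
proof -
  let ?E = "tilde_edges S m k"
  interpret symmetric_edges S ?E
    by (rule symmetric_edges_tilde[OF k])
  obtain f where f: "f \<in> hom (chains1 ?E) complex_units" "\<chi> = restrict f (carrier (H1 S ?E))"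
    "\<And>r t. (r, t) \<in> ?E \<Longrightarrow> c r t * f (edge_chain ?E r t) = edge_two_cos k r t"
    using c by (rule matchesE) blast
  obtain f' where f': "f' \<in> hom (chains1 ?E) complex_units" "\<chi> = restrict f' (carrier (H1 S ?E))"
    "\<And>r t. (r, t) \<in> ?E \<Longrightarrow> c' r t * f' (edge_chain ?E r t) = edge_two_cos k r t"
    using c' by (rule matchesE) blast
  have "restrict f (carrier (H1 S ?E)) = restrict f' (carrier (H1 S ?E))"
    using f(2) f'(2) by simp
  then obtain x where x: "\<And>v. x v \<noteq> 0"
    and fx: "\<And>r t. (r, t) \<in> ?E \<Longrightarrow> f' (edge_chain ?E r t) = f (edge_chain ?E r t) * (x r / x t)"
    unfolding restrict_H1_eq_iff[OF f(1) f'(1)] by blast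
  have "c' s t = c s t * (x t / x s)" if st: "s \<in> S" "t \<in> S" for s t
  proof -
    consider "s = t" | "(s, t) \<in> ?E" | "s \<noteq> t" "edge_two_cos k s t = 0"
      using st tilde_edges_iff[OF k] by blast
    then show ?thesis
    proof cases
      case 1
      then show ?thesis
        using diag st x by simp
    next
      case 2
      then have "edge_two_cos k s t \<noteq> 0"
        by (simp add: tilde_edges_iff[OF k])
      then have "f (edge_chain ?E s t) \<noteq> 0"
        "c' s t * (f (edge_chain ?E s t) * (x s / x t)) = c s t * f (edge_chain ?E s t)"
        using f(3)[OF 2] f'(3)[OF 2] fx[OF 2] by auto
      then show ?thesis
        using x by (simp add: field_simps)
    next
      case 3
      then show ?thesis
        using c c' st by (auto simp: matches_def)
    qed
  qed
  with x show thesis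
    by (rule that)
qed

text \<open>Extend \<chi> to a homomorphism \<open>f\<close> on chains and divide the cosines by its
  edge values. Opposite edges have inverse values, so \<open>c r t * c t r\<close> comes out as the
  square of the cosine term.\<close>

lemma matching_matrix_exists:
  assumes "(k, \<chi>) \<in> IR_data S m"
  obtains c where "\<And>s. c s s = -2" "matches k \<chi> c"
proof -
  have k: "valid_exponents k" and \<chi>: "\<chi> \<in> characters (H1 S (tilde_edges S m k))"
    using assms by (auto simp: IR_data_iff)
  let ?E = "tilde_edges S m k"
  interpret symmetric_edges S ?E
    by (rule symmetric_edges_tilde[OF k])
  obtain f where f: "f \<in> hom (chains1 ?E) complex_units" "\<chi> = restrict f (carrier (H1 S ?E))"
    using character_extends[OF \<chi>] by blast
  define c where "c r t = (if r = t then -2 else if (r, t) \<in> ?E then edge_two_cos k r t / f (edge_chain ?E r t) else 0)" for r t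
  have prod: "c r t * c t r = (edge_two_cos k r t)\<^sup>2 \<and> (edge_two_cos k r t = 0 \<longrightarrow> c r t = 0)"
    if rt: "r \<in> S" "t \<in> S" "r \<noteq> t" for r t
  proof (cases "edge_two_cos k r t = 0")
    case True
    then show ?thesis
      using rt by (simp add: c_def tilde_edges_iff[OF k])
  next
    case False
    then have "(r, t) \<in> ?E"
      using rt by (simp add: tilde_edges_iff[OF k])
    note e = this reversed[OF this]
    have "c r t * c t r = (edge_two_cos k r t)\<^sup>2 / (f (edge_chain ?E r t) * f (edge_chain ?E t r))"
      using e rt edge_two_cos_commute[OF k rt] by (simp add: c_def power2_eq_square)
    then show ?thesis
      using False hom_edge_chain_reverse[OF f(1) e(1)] by simp
  qed
  have edge: "c r t * f (edge_chain ?E r t) = edge_two_cos k r t" if e: "(r, t) \<in> ?E" for r t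
  proof -
    have "f (edge_chain ?E r t) \<noteq> 0"
      using hom_edge_chain_reverse[OF f(1) e] by (metis mult_zero_left zero_neq_one)
    moreover have "r \<noteq> t"
      using e by (simp add: tilde_edges_iff[OF k])
    ultimately show ?thesis
      using e by (simp add: c_def)
  qed
  show thesis
  proof (rule that)
    show "c s s = -2" for s
      by (simp add: c_def)
    show "matches k \<chi> c"
      unfolding matches_def using prod edge f by blast
  qed
qed

section \<open>Comparison with the numbers \<open>a\<close> in the definition of the attached
  data\<close>

lemma ratio_realizable:
  assumes "\<And>r t. \<lbrakk>r \<in> S; t \<in> S; r \<noteq> t\<rbrakk> \<Longrightarrow> g r t * g t r = (1 :: complex)"
  obtains a where "\<And>r t. \<lbrakk>r \<in> S; t \<in> S; r \<noteq> t\<rbrakk> \<Longrightarrow> a r t \<noteq> 0 \<and> a t r = g r t * a r t"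
proof -
  obtain i :: "'g \<Rightarrow> nat" where i: "inj_on i S"
    using finite_S finite_imp_inj_to_nat_seg by metis
  show thesis
  \<comment> \<open>An injection into the naturals orders each pair: one of the two numbers is set
    to 1 and the other takes up the whole ratio. Different pairs do not interact.\<close>
  proof (rule that[of "\<lambda>r t. if i r < i t then 1 else g t r"])
    fix r t assume rt: "r \<in> S" "t \<in> S" "r \<noteq> t"
    then have "i r \<noteq> i t"
      using i by (auto dest: inj_onD)
    then show "(if i r < i t then 1 else g t r) \<noteq> 0 \<and>
        (if i t < i r then 1 else g r t) = g r t * (if i r < i t then 1 else g t r)"
      using assms[OF rt] by auto
  qed
qed

text \<open>Eliminates the numbers \<open>a\<close>: by \<open>dihedral_iso_iff\<close> they enter
  only through their ratios, and any ratios inverse to each other on opposite pairs can be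
  realized.\<close>

lemma has_data_iff:
  assumes G: "group_representation W V \<rho>"
  shows "has_data S m (V, \<rho>) (k, \<chi>) \<longleftrightarrow>
    valid_exponents k \<and> (\<exists>\<alpha> c. refl_matrix S V \<rho> \<alpha> c \<and> matches k \<chi> c)"
    (is "?L \<longleftrightarrow> ?R")
proof
  let ?E = "tilde_edges S m k"
  have lin: "linear_map_on V V (\<rho> s)" if "s \<in> S" for s
    using group_representationD(2)[OF G] that by simp
  note V = group_representationD(1)[OF G]
  {
    assume ?L
    then obtain \<alpha> a f where k: "k \<in> extensional (off_diagonal S)" and IR: "IR_basis S V \<rho> \<alpha>"
      and a: "\<forall>(r, t) \<in> off_diagonal S. k (r, t) = k (t, r) \<and> 1 \<le> k (r, t) \<and> 2 * k (r, t) \<le> m r t \<and>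
           a r t \<noteq> 0 \<and> a t r \<noteq> 0 \<and> dihedral_iso \<rho> \<alpha> r t (m r t) (k (r, t)) (a r t) (a t r)"
      and f: "f \<in> hom (chains1 ?E) complex_units"
        "\<forall>(r, t) \<in> ?E. f (edge_chain ?E r t) = a t r / a r t" "\<chi> = restrict f (carrier (H1 S ?E))"
      unfolding has_data_def by auto
    have valid: "valid_exponents k"
      using k a by (auto simp: valid_exponents_def off_diagonal_def)
    obtain c where R: "refl_matrix S V \<rho> \<alpha> c"
      using IR_basis_imp_refl_matrix[OF finite_S V lin IR] by blast
    have ac: "a r t \<noteq> 0 \<and> a t r \<noteq> 0 \<and> c r t * a t r = edge_two_cos k r t * a r t \<and> c t r * a r t = edge_two_cos k r t * a t r"
      if rt: "r \<in> S" "t \<in> S" "r \<noteq> t" for r t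
    proof -
      have "dihedral_iso \<rho> \<alpha> r t (m r t) (k (r, t)) (a r t) (a t r)"
        using a rt by (auto simp: off_diagonal_def)
      then show ?thesis
        unfolding dihedral_iso_iff[OF R rt lin[OF rt(1)] lin[OF rt(2)]] edge_two_cos_def by blast
    qed
    have "c r t * c t r = (edge_two_cos k r t)\<^sup>2 \<and> (edge_two_cos k r t = 0 \<longrightarrow> c r t = 0)"
      if rt: "r \<in> S" "t \<in> S" "r \<noteq> t" for r t
    proof -
      have "(c r t * a t r) * (c t r * a r t) = (edge_two_cos k r t * a r t) * (edge_two_cos k r t * a t r)"
        using ac[OF rt] by simp
      then have "(c r t * c t r) * (a r t * a t r) = (edge_two_cos k r t)\<^sup>2 * (a r t * a t r)"
        by (simp add: power2_eq_square mult_ac)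
      then show ?thesis
        using ac[OF rt] by auto
    qed
    moreover have "c r t * f (edge_chain ?E r t) = edge_two_cos k r t" if e: "(r, t) \<in> ?E" for r t
    proof -
      have "r \<in> S" "t \<in> S" "r \<noteq> t"
        using e by (auto simp: tilde_edges_iff[OF valid])
      from ac[OF this] have "c r t * (a t r / a r t) = edge_two_cos k r t"
        by (simp add: field_simps)
      then show ?thesis
        using f(2) e by auto
    qed
    ultimately have "matches k \<chi> c"
      unfolding matches_def using f(1,3) by blast
    with valid R show ?R
      by blast
  next
    assume ?R
    then obtain \<alpha> c where valid: "valid_exponents k" and R: "refl_matrix S V \<rho> \<alpha> c" and c: "matches k \<chi> c"
      by blast
    obtain f where f: "f \<in> hom (chains1 ?E) complex_units" "\<chi> = restrict f (carrier (H1 S ?E))"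
      "\<And>r t. (r, t) \<in> ?E \<Longrightarrow> c r t * f (edge_chain ?E r t) = edge_two_cos k r t"
      using c by (rule matchesE) blast
    interpret symmetric_edges S ?E
      by (rule symmetric_edges_tilde[OF valid])
    \<comment> \<open>Off the edges both the cosine and the coefficients vanish, so any nonzero
      ratio would satisfy the equations; 1 is taken.\<close>
    define g where "g r t = (if (r, t) \<in> ?E then f (edge_chain ?E r t) else 1)" for r t
    have g1: "g r t * g t r = 1" for r t
      using hom_edge_chain_reverse[OF f(1), of r t] reversed[of r t] reversed[of t r]
      by (auto simp: g_def)
    then obtain a where a: "\<And>r t. \<lbrakk>r \<in> S; t \<in> S; r \<noteq> t\<rbrakk> \<Longrightarrow> a r t \<noteq> 0 \<and> a t r = g r t * a r t"
      using ratio_realizable[of g] by metis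
    have cg: "c r t * g r t = edge_two_cos k r t" if rt: "r \<in> S" "t \<in> S" "r \<noteq> t" for r t
      using f(3)[of r t] c rt by (auto simp: g_def tilde_edges_iff[OF valid] matches_def)
    have iso: "dihedral_iso \<rho> \<alpha> r t (m r t) (k (r, t)) (a r t) (a t r)"
      if rt: "r \<in> S" "t \<in> S" "r \<noteq> t" for r t
    proof -
      have "a r t \<noteq> 0" "a t r \<noteq> 0" "a t r = g r t * a r t" "a r t = g t r * a t r"
        using a[OF rt] a[of t r] rt by auto
      moreover have "c r t * (g r t * a r t) = edge_two_cos k r t * a r t" "c t r * (g t r * a t r) = edge_two_cos k r t * a t r"
        using cg[OF rt] cg[of t r] rt edge_two_cos_commute[OF valid rt] by (simp_all flip: mult.assoc)
      ultimately show ?thesis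
        unfolding dihedral_iso_iff[OF R rt lin[OF rt(1)] lin[OF rt(2)]] edge_two_cos_def[symmetric] by metis
    qed
    have IR: "IR_basis S V \<rho> \<alpha>"
      by (rule refl_matrix_imp_IR_basis[OF finite_S lin R])
    have off: "\<forall>(r, t) \<in> off_diagonal S. k (r, t) = k (t, r) \<and> 1 \<le> k (r, t) \<and> 2 * k (r, t) \<le> m r t \<and>
           a r t \<noteq> 0 \<and> a t r \<noteq> 0 \<and> dihedral_iso \<rho> \<alpha> r t (m r t) (k (r, t)) (a r t) (a t r)"
    proof clarify
      fix r t assume "(r, t) \<in> off_diagonal S"
      then have rt: "r \<in> S" "t \<in> S" "r \<noteq> t"
        by (auto simp: off_diagonal_def)
      show "k (r, t) = k (t, r) \<and> 1 \<le> k (r, t) \<and> 2 * k (r, t) \<le> m r t \<and>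
           a r t \<noteq> 0 \<and> a t r \<noteq> 0 \<and> dihedral_iso \<rho> \<alpha> r t (m r t) (k (r, t)) (a r t) (a t r)"
        using valid_exponentsD[OF valid rt] a[OF rt] a[of t r] rt iso[OF rt] by blast
    qed
    have "f (edge_chain ?E r t) = a t r / a r t" if e: "(r, t) \<in> ?E" for r t
      using a[of r t] e by (auto simp: tilde_edges_iff[OF valid] g_def)
    then have fa: "\<forall>(r, t) \<in> ?E. f (edge_chain ?E r t) = a t r / a r t"
      by blast
    have "k \<in> extensional (off_diagonal S)"
      using valid by (simp add: valid_exponents_def)
    then show ?L
      unfolding has_data_def prod.case using IR off f(1,2) fa by blast
  }
qed

lemma IR_reps_iff: "(V, \<rho>) \<in> IR_reps W S \<longleftrightarrow> group_representation W V \<rho> \<and> (\<exists>\<alpha> c. refl_matrix S V \<rho> \<alpha> c)"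
proof -
  have "(\<exists>\<alpha>. IR_basis S V \<rho> \<alpha>) \<longleftrightarrow> (\<exists>\<alpha> c. refl_matrix S V \<rho> \<alpha> c)" if G: "group_representation W V \<rho>"
  proof -
    have lin: "linear_map_on V V (\<rho> s)" if "s \<in> S" for s
      using group_representationD(2)[OF G] that by simp
    show ?thesis
      using IR_basis_imp_refl_matrix[of S V \<rho>, OF finite_S group_representationD(1)[OF G] lin]
        refl_matrix_imp_IR_basis[of S V \<rho>, OF finite_S lin] by blast
  qed
  then show ?thesis
    by (auto simp: IR_reps_def)
qed

text \<open>Existence comes from the matrix of any IR-basis. Two IR-bases differ by a gauge change,
  under which the data are invariant, so \<open>attached_data\<close> is well defined.\<close>

lemma has_data_unique:
  assumes "R \<in> IR_reps W S"
  shows "\<exists>!d. has_data S m R d"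
proof -
  obtain V \<rho> where VR: "R = (V, \<rho>)"
    by fastforce
  then have G: "group_representation W V \<rho>"
    using assms by (simp add: IR_reps_iff)
  obtain \<alpha> c where c: "refl_matrix S V \<rho> \<alpha> c"
    using assms VR by (auto simp: IR_reps_iff)
  obtain k \<chi> where k: "valid_exponents k" "matches k \<chi> c"
    using matches_exists[OF G c] by blast
  show ?thesis
  proof (rule ex1I[of _ "(k, \<chi>)"])
    show "has_data S m R (k, \<chi>)"
      using VR has_data_iff[OF G] k c by blast
    fix d assume d: "has_data S m R d"
    obtain k' \<chi>' where d': "d = (k', \<chi>')"
      by fastforce
    then obtain \<alpha>' c' where k': "valid_exponents k'" "refl_matrix S V \<rho> \<alpha>' c'" "matches k' \<chi>' c'"
      using d VR has_data_iff[OF G] by blast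
    obtain x where "\<And>s. x s \<noteq> 0" "\<And>s t. s \<in> S \<Longrightarrow> t \<in> S \<Longrightarrow> c' s t = c s t * (x t / x s)"
      using refl_matrix_gauge[OF G c k'(2)] by blast
    from matches_unique[OF k k'(1,3) this] show "d = (k, \<chi>)"
      using d' by simp
  qed
qed

section \<open>Isomorphism classes and their data\<close>

lemma has_data_attached: "R \<in> IR_reps W S \<Longrightarrow> has_data S m R (attached_data S m R)"
  unfolding attached_data_def by (rule theI'[OF has_data_unique])

lemma attached_data_eqI: "R \<in> IR_reps W S \<Longrightarrow> has_data S m R d \<Longrightarrow> attached_data S m R = d"
  using has_data_attached has_data_unique by blast

lemma IR_isoE:
  assumes "(R, R') \<in> IR_iso W S"
  obtains V \<rho> V' \<rho>' \<phi> where "R = (V, \<rho>)" "R' = (V', \<rho>')" "R \<in> IR_reps W S" "R' \<in> IR_reps W S"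
    "linear_map_on V V' \<phi>" "bij_betw \<phi> V V'" "\<And>w x. w \<in> carrier W \<Longrightarrow> x \<in> V \<Longrightarrow> \<phi> (\<rho> w x) = \<rho>' w (\<phi> x)"
  using assms unfolding IR_iso_def by blast

lemma has_data_transport:
  assumes "(R, R') \<in> IR_iso W S" "has_data S m R d"
  shows "has_data S m R' d"
proof -
  obtain V \<rho> V' \<rho>' \<phi> where R: "R = (V, \<rho>)" "R' = (V', \<rho>')" "R \<in> IR_reps W S" "R' \<in> IR_reps W S"
    and \<phi>: "linear_map_on V V' \<phi>" "bij_betw \<phi> V V'"
    and equi: "\<And>w x. w \<in> carrier W \<Longrightarrow> x \<in> V \<Longrightarrow> \<phi> (\<rho> w x) = \<rho>' w (\<phi> x)"
    using assms(1) by (rule IR_isoE) blast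
  have G: "group_representation W V \<rho>" and G': "group_representation W V' \<rho>'"
    using R by (auto simp: IR_reps_iff)
  obtain k \<chi> where d: "d = (k, \<chi>)"
    by fastforce
  then obtain \<alpha> c where c: "valid_exponents k" "refl_matrix S V \<rho> \<alpha> c" "matches k \<chi> c"
    using assms(2) R(1) has_data_iff[OF G] by blast
  have "refl_matrix S V' \<rho>' (\<phi> \<circ> \<alpha>) c"
    by (rule refl_matrix_transport[OF c(2) \<phi>]) (simp add: equi)
  then show ?thesis
    unfolding d R(2) has_data_iff[OF G'] using c(1,3) by blast
qed

text \<open>Equal data make the two matrices gauge equivalent, and the gauge factors rescale one
  basis onto the other.\<close>

lemma same_data_imp_iso:
  assumes "R \<in> IR_reps W S" "R' \<in> IR_reps W S" "has_data S m R d" "has_data S m R' d"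
  shows "(R, R') \<in> IR_iso W S"
proof -
  obtain V \<rho> V' \<rho>' k \<chi> where eq: "R = (V, \<rho>)" "R' = (V', \<rho>')" "d = (k, \<chi>)"
    by (meson surj_pair)
  have G: "group_representation W V \<rho>" and G': "group_representation W V' \<rho>'"
    using assms eq by (auto simp: IR_reps_iff)
  obtain \<alpha> c where c: "valid_exponents k" "refl_matrix S V \<rho> \<alpha> c" "matches k \<chi> c"
    using assms(3) eq has_data_iff[OF G] by blast
  obtain \<alpha>' c' where c': "refl_matrix S V' \<rho>' \<alpha>' c'" "matches k \<chi> c'"
    using assms(4) eq has_data_iff[OF G'] by blast
  obtain x where x: "\<And>s. x s \<noteq> 0" "\<And>s t. s \<in> S \<Longrightarrow> t \<in> S \<Longrightarrow> c' s t = c s t * (x t / x s)"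
    using matches_gauge[OF c(1,3) c'(2) refl_matrixD(5)[OF c(2)] refl_matrixD(5)[OF c'(1)]] by blast
  show ?thesis
    using refl_matrix_iso[OF G G' c(2) c'(1) x] assms(1,2) unfolding eq IR_iso_def by blast
qed

lemma IR_iso_iff:
  "(R, R') \<in> IR_iso W S \<longleftrightarrow>
     R \<in> IR_reps W S \<and> R' \<in> IR_reps W S \<and> attached_data S m R = attached_data S m R'"
proof
  assume iso: "(R, R') \<in> IR_iso W S"
  then have "R \<in> IR_reps W S" "R' \<in> IR_reps W S"
    by (auto elim: IR_isoE)
  then show "R \<in> IR_reps W S \<and> R' \<in> IR_reps W S \<and> attached_data S m R = attached_data S m R'"
    using has_data_transport[OF iso has_data_attached] attached_data_eqI by metis
next
  assume "R \<in> IR_reps W S \<and> R' \<in> IR_reps W S \<and> attached_data S m R = attached_data S m R'"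
  then show "(R, R') \<in> IR_iso W S"
    using same_data_imp_iso has_data_attached by metis
qed

lemma attached_data_in_IR_data:
  assumes "R \<in> IR_reps W S"
  shows "attached_data S m R \<in> IR_data S m"
proof -
  obtain V \<rho> k \<chi> where eq: "R = (V, \<rho>)" "attached_data S m R = (k, \<chi>)"
    by (meson surj_pair)
  have G: "group_representation W V \<rho>"
    using assms eq by (simp add: IR_reps_iff)
  have "has_data S m (V, \<rho>) (k, \<chi>)"
    using has_data_attached[OF assms] unfolding eq(2) unfolding eq(1) .
  then have "valid_exponents k \<and> (\<exists>\<alpha> c. refl_matrix S V \<rho> \<alpha> c \<and> matches k \<chi> c)"
    unfolding has_data_iff[OF G] .
  then show ?thesis
    unfolding eq(2) using matches_in_IR_data by blast
qed

lemma data_realizable: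
  assumes "d \<in> IR_data S m" and B: "finite B" "card B = card S" "independent B"
  shows "\<exists>R \<in> IR_reps W S. attached_data S m R = d"
proof -
  obtain k \<chi> where d: "d = (k, \<chi>)"
    by fastforce
  have valid: "valid_exponents k"
    using assms(1) d by (simp add: IR_data_iff)
  obtain c where c: "\<And>s. c s s = -2" "matches k \<chi> c"
    using matching_matrix_exists assms(1) d by metis
  have "\<exists>k. 1 \<le> k \<and> 2 * k \<le> m r t \<and> c r t * c t r = (two_cos (m r t) k)\<^sup>2 \<and>
      (two_cos (m r t) k = 0 \<longrightarrow> c r t = 0 \<and> c t r = 0)" if rt: "r \<in> S" "t \<in> S" "r \<noteq> t" for r t
  proof (intro exI conjI)
    show "1 \<le> k (r, t)" "2 * k (r, t) \<le> m r t"
      using valid_exponentsD[OF valid rt] by auto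
    show "c r t * c t r = (two_cos (m r t) (k (r, t)))\<^sup>2"
      using c(2) rt by (auto simp: matches_def edge_two_cos_def)
    show "two_cos (m r t) (k (r, t)) = 0 \<longrightarrow> c r t = 0 \<and> c t r = 0"
      using c(2) rt edge_two_cos_commute[OF valid rt] by (auto simp: matches_def edge_two_cos_def)
  qed
  then obtain V \<rho> \<alpha> where G: "group_representation W V \<rho>" and R: "refl_matrix S V \<rho> \<alpha> c"
    using representation_exists[OF B, of c] c(1) by blast
  have "(V, \<rho>) \<in> IR_reps W S"
    using G R by (auto simp: IR_reps_iff)
  moreover have "has_data S m (V, \<rho>) d"
    unfolding d has_data_iff[OF G] using valid R c(2) by blast
  ultimately show ?thesis
    using attached_data_eqI by blast
qed

end

theorem theorem4p10:
  fixes W :: "('g, 'b) monoid_scheme" and S :: "'g set" and m :: "'g \<Rightarrow> 'g \<Rightarrow> nat"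
    and scale :: "complex \<Rightarrow> 'v::ab_group_add \<Rightarrow> 'v"
  assumes "coxeter_system W S m"
    and "finite S"
    and "\<forall>r\<in>S. \<forall>t\<in>S. m r t \<noteq> 0"
    and "complex_vector_space scale"
    and "\<exists>B. finite B \<and> card B = card S \<and> \<not> module.dependent scale B"
  shows "(\<forall>R \<in> complex_vector_space.IR_reps scale W S.
            \<exists>!d. complex_vector_space.has_data scale S m R d) \<and>
         equiv (complex_vector_space.IR_reps scale W S) (complex_vector_space.IR_iso scale W S) \<and>
         (\<forall>(R, R') \<in> complex_vector_space.IR_iso scale W S.
            complex_vector_space.attached_data scale S m R
              = complex_vector_space.attached_data scale S m R') \<and>
         bij_betw (\<lambda>C. the_elem (complex_vector_space.attached_data scale S m ` C))
           (complex_vector_space.IR_reps scale W S // complex_vector_space.IR_iso scale W S)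
           (IR_data S m)"
proof -
  interpret coxeter_IR scale W S m
    by (intro coxeter_IR.intro coxeter_IR_axioms.intro) (use assms in auto)
  \<comment> \<open>The independent set \<open>B\<close> guarantees that the ambient space has room
    for a representation of dimension \<open>card S\<close>; surjectivity rests on it.\<close>
  obtain B where B: "finite B" "card B = card S" "independent B"
    using assms(5) by blast
  have equiv: "equiv (IR_reps W S) (IR_iso W S)"
    by (rule equivI) (auto simp: IR_iso_iff refl_on_def sym_def trans_def)
  \<comment> \<open>The data are constant on each isomorphism class, so their image is a singleton
    and \<open>the_elem\<close> returns the common value.\<close>
  have chain_class: "the_elem (attached_data S m ` (IR_iso W S `` {R})) = attached_data S m R"
    if "R \<in> IR_reps W S" for R
  proof -
    have "attached_data S m ` (IR_iso W S `` {R}) = {attached_data S m R}"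
      using that by (auto simp: IR_iso_iff image_iff)
    then show ?thesis
      by simp
  qed
  have "bij_betw (\<lambda>C. the_elem (attached_data S m ` C)) (IR_reps W S // IR_iso W S) (IR_data S m)"
  proof (rule bij_betw_imageI)
    show "inj_on (\<lambda>C. the_elem (attached_data S m ` C)) (IR_reps W S // IR_iso W S)"
    proof (rule inj_onI)
      fix C C' assume C: "C \<in> IR_reps W S // IR_iso W S" "C' \<in> IR_reps W S // IR_iso W S"
        and eq: "the_elem (attached_data S m ` C) = the_elem (attached_data S m ` C')"
      obtain R R' where R: "R \<in> IR_reps W S" "C = IR_iso W S `` {R}"
        "R' \<in> IR_reps W S" "C' = IR_iso W S `` {R'}"
        using C by (auto elim!: quotientE)
      then have "(R, R') \<in> IR_iso W S"
        using eq chain_class by (simp add: IR_iso_iff)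
      then show "C = C'"
        using R equiv_class_eq[OF equiv] by blast
    qed
    show "(\<lambda>C. the_elem (attached_data S m ` C)) ` (IR_reps W S // IR_iso W S) = IR_data S m"
    proof
      show "(\<lambda>C. the_elem (attached_data S m ` C)) ` (IR_reps W S // IR_iso W S) \<subseteq> IR_data S m"
        using chain_class attached_data_in_IR_data by (auto elim!: quotientE)
      show "IR_data S m \<subseteq> (\<lambda>C. the_elem (attached_data S m ` C)) ` (IR_reps W S // IR_iso W S)"
      proof
        fix d assume "d \<in> IR_data S m"
        then obtain R where R: "R \<in> IR_reps W S" "attached_data S m R = d"
          using data_realizable B by blast
        then have "d = the_elem (attached_data S m ` (IR_iso W S `` {R}))"
          using chain_class by simp
        then show "d \<in> (\<lambda>C. the_elem (attached_data S m ` C)) ` (IR_reps W S // IR_iso W S)"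
          using quotientI[OF R(1)] by blast
      qed
    qed
  qed
  moreover have "\<forall>(R, R') \<in> IR_iso W S. attached_data S m R = attached_data S m R'"
    using IR_iso_iff by blast
  ultimately show ?thesis
    using equiv has_data_unique by blast
qed

end
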